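(* Let $n\ge1$. 1. There is a homomorphism of Lie algebras $\psi:\mathfrak t^{trig}_{A_n}\to\mathfrak t_{A_{n+1}}$ which is an injection on the space of generators (the linear span of the generators $t_{ij}$, $\tau(h)$). 2. Let $\pi:\mathfrak t_{A_{n+1}}\to\mathfrak t_{A_{n+1}}/\langle\sum_{0\le i<j\le n+1}t_{ij}\rangle$ be the projection onto the quotient by the indicated central element. Then $\pi\circ\psi:\mathfrak t^{trig}_{A_n}\to\mathfrak t_{A_{n+1}}/\langle\sum_{0\le i<j\le n+1}t_{ij}\rangle$ is a surjective homomorphism. 3. Let $C=\mathrm{diag}(z_1,\dots,z_{n+1})\in T^{reg}$. Then $\psi(Q(C))=G(\chi)$ with $\chi=\mathrm{diag}(0,z_1,\dots,z_{n+1})$. (The homomorphism $\psi$ is the same in all three statements.)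
   Context: Everything is over $\mathbb C$. Rational holonomy Lie algebra of type $A_{n+1}$: $\mathfrak t_{A_{n+1}}$ is generated by $t_{ij}=t_{ji}$, $0\le i\ne j\le n+1$ (with $t_{ij}$ attached to the root $\varepsilon_i-\varepsilon_j$), with relations $[t_{ij},t_{ik}+t_{jk}]=0$ for distinct $i,j,k$ and $[t_{ij},t_{kl}]=0$ for distinct $i,j,k,l$. The element $\sum_{i<j}t_{ij}$ is central. For $\chi=\mathrm{diag}(\chi_0,\dots,\chi_{n+1})$ with pairwise distinct entries (modulo scalar matrices), the Gaudin subspace $G(\chi)$ is the span of the elements $H(h,\chi)=\sum_{i<j}\frac{h_i-h_j}{\chi_i-\chi_j}t_{ij}$ over all diagonal $h=\mathrm{diag}(h_0,\dots,h_{n+1})$. Trigonometric holonomy Lie algebra of type $A_n$: let $\Phi$ be the root system $\{\varepsilon_i-\varepsilon_j:1\le i\ne j\le n+1\}$, $\Phi^+=\{\varepsilon_i-\varepsilon_j:i<j\}$, $R$ the root lattice, $\mathfrak h=\mathrm{Hom}_{\mathbb Z}(R,\mathbb C)$ (diagonal matrices modulo scalars), $T=\mathrm{Hom}_{\mathbb Z}(R,\mathbb C^\times)$ (invertible diagonal matrices modulo scalars), with $e^{\varepsilon_i-\varepsilon_j}(\mathrm{diag}(z))=z_i/z_j$. The Lie algebra $\mathfrak t^{trig}_{A_n}$ is generated by $t_{ij}=t_{ji}$, $1\le i\neq j\le n+1$, and $\tau(h)$, $h\in\mathfrak h$, with relations: $[t_{ij},t_{ik}+t_{jk}]=0$ and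 $[t_{ij},t_{kl}]=0$ for distinct indices; $\tau$ is linear in $h$; $[\tau(h),\tau(h')]=0$; and $[t_\alpha,\delta(h)]=0$ whenever $\alpha(h)=0$, where $\delta(h)=\tau(h)-\frac12\sum_{\alpha\in\Phi^+}\alpha(h)t_\alpha$ and $t_{\varepsilon_i-\varepsilon_j}=t_{ij}$. $T^{reg}\subset T$ is the set of classes of diagonal matrices with pairwise distinct nonzero entries. For $C\in T^{reg}$, the Bethe subspace $Q(C)$ is the span over $h\in\mathfrak h$ of $BH(C,h)=\tau(h)-\sum_{\alpha\in\Phi^+}\frac{e^\alpha(C)\alpha(h)}{e^\alpha(C)-1}t_\alpha$.
   Formalization: In part 3 the equality ψ(Q(C)) = G(χ), impossible since dim Q(C) ≤ n while dim G(χ) = n+1, is replaced by G(χ) = ψ(Q(C)) ⊕ ℂ·Σ_{i<j} t_ij, i.e. equality holds modulo the central element. *)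

theory Defs
  imports Complex_Main "HOL-Library.FuncSet" "HOL-Algebra.AbelCoset" "HOL-Algebra.Module"
begin

section \<open>Complex Lie algebras with explicit carriers\<close>

definition CC :: "complex ring"
  where "CC = \<lparr> carrier = UNIV, mult = (*), one = 1, zero = 0, add = (+) \<rparr>"

text \<open>As for modules in HOL-Algebra, the inherited fields \<open>mult\<close> and \<open>one\<close> carry no meaning.\<close>

record 'a lie_alg = "(complex, 'a) module" +
  bracket :: "'a \<Rightarrow> 'a \<Rightarrow> 'a"

locale lie_algebra = module CC L for L :: "('a, 'm) lie_alg_scheme" (structure) +
  assumes bracket_closed:
      "\<lbrakk>x \<in> carrier L; y \<in> carrier L\<rbrakk> \<Longrightarrow> bracket L x y \<in> carrier L"
    and bracket_add_left:
      "\<lbrakk>x \<in> carrier L; y \<in> carrier L; z \<in> carrier L\<rbrakk> \<Longrightarrow>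
       bracket L (x \<oplus> y) z = bracket L x z \<oplus> bracket L y z"
    and bracket_add_right:
      "\<lbrakk>x \<in> carrier L; y \<in> carrier L; z \<in> carrier L\<rbrakk> \<Longrightarrow>
       bracket L x (y \<oplus> z) = bracket L x y \<oplus> bracket L x z"
    and bracket_smult_left:
      "\<lbrakk>x \<in> carrier L; y \<in> carrier L\<rbrakk> \<Longrightarrow> bracket L (c \<odot> x) y = c \<odot> bracket L x y"
    and bracket_smult_right:
      "\<lbrakk>x \<in> carrier L; y \<in> carrier L\<rbrakk> \<Longrightarrow> bracket L x (c \<odot> y) = c \<odot> bracket L x y"
    and bracket_self: "x \<in> carrier L \<Longrightarrow> bracket L x x = \<zero>"
    and jacobi:
      "\<lbrakk>x \<in> carrier L; y \<in> carrier L; z \<in> carrier L\<rbrakk> \<Longrightarrow>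
       bracket L x (bracket L y z) \<oplus> bracket L y (bracket L z x) \<oplus> bracket L z (bracket L x y) = \<zero>"

definition lie_hom ::
    "('a, 'm) lie_alg_scheme \<Rightarrow> ('b, 'k) lie_alg_scheme \<Rightarrow> ('a \<Rightarrow> 'b) set"
  where "lie_hom L M = {f \<in> carrier L \<rightarrow> carrier M.
    (\<forall>x\<in>carrier L. \<forall>y\<in>carrier L. f (x \<oplus>\<^bsub>L\<^esub> y) = f x \<oplus>\<^bsub>M\<^esub> f y) \<and>
    (\<forall>c. \<forall>x\<in>carrier L. f (c \<odot>\<^bsub>L\<^esub> x) = c \<odot>\<^bsub>M\<^esub> f x) \<and>
    (\<forall>x\<in>carrier L. \<forall>y\<in>carrier L. f (bracket L x y) = bracket M (f x) (f y))}"

definition lin_span :: "('a, 'm) lie_alg_scheme \<Rightarrow> 'a set \<Rightarrow> 'a set"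
  where "lin_span L S = \<Inter>{H. submodule H CC L \<and> S \<subseteq> H}"

definition lie_ideal :: "'a set \<Rightarrow> ('a, 'm) lie_alg_scheme \<Rightarrow> bool"
  where "lie_ideal I L \<longleftrightarrow> submodule I CC L \<and> (\<forall>x\<in>carrier L. \<forall>y\<in>I. bracket L x y \<in> I)"

definition lie_ideal_gen :: "('a, 'm) lie_alg_scheme \<Rightarrow> 'a set \<Rightarrow> 'a set"
  where "lie_ideal_gen L S = \<Inter>{I. lie_ideal I L \<and> S \<subseteq> I}"

definition lie_quot :: "('a, 'm) lie_alg_scheme \<Rightarrow> 'a set \<Rightarrow> 'a set lie_alg"
  where "lie_quot L I =
    \<lparr> carrier = a_rcosets\<^bsub>L\<^esub> I, mult = undefined, one = undefined, zero = I, add = set_add L,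
      smult = (\<lambda>c A. \<Union>x\<in>A. I +>\<^bsub>L\<^esub> (c \<odot>\<^bsub>L\<^esub> x)),
      bracket = (\<lambda>A B. \<Union>x\<in>A. \<Union>y\<in>B. I +>\<^bsub>L\<^esub> bracket L x y) \<rparr>"


section \<open>Free Lie algebras and presentations\<close>

datatype 'x lie_term =
    Gen 'x
  | Zero
  | Add "'x lie_term" "'x lie_term"
  | Scale complex "'x lie_term"
  | Bracket "'x lie_term" "'x lie_term"

inductive lie_eq :: "'x lie_term \<Rightarrow> 'x lie_term \<Rightarrow> bool" where
  refl: "lie_eq s s"
| sym: "lie_eq s t \<Longrightarrow> lie_eq t s"
| trans: "lie_eq s t \<Longrightarrow> lie_eq t u \<Longrightarrow> lie_eq s u"
| cong_add: "lie_eq s s' \<Longrightarrow> lie_eq t t' \<Longrightarrow> lie_eq (Add s t) (Add s' t')"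
| cong_scale: "lie_eq s s' \<Longrightarrow> lie_eq (Scale c s) (Scale c s')"
| cong_bracket: "lie_eq s s' \<Longrightarrow> lie_eq t t' \<Longrightarrow> lie_eq (Bracket s t) (Bracket s' t')"
| add_assoc: "lie_eq (Add (Add s t) u) (Add s (Add t u))"
| add_comm: "lie_eq (Add s t) (Add t s)"
| add_zero: "lie_eq (Add Zero s) s"
| add_neg: "lie_eq (Add (Scale (-1) s) s) Zero"
| scale_add: "lie_eq (Scale c (Add s t)) (Add (Scale c s) (Scale c t))"
| add_scale: "lie_eq (Scale (c + d) s) (Add (Scale c s) (Scale d s))"
| scale_scale: "lie_eq (Scale (c * d) s) (Scale c (Scale d s))"
| scale_one: "lie_eq (Scale 1 s) s"
| bracket_add_left: "lie_eq (Bracket (Add s t) u) (Add (Bracket s u) (Bracket t u))"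
| bracket_add_right: "lie_eq (Bracket s (Add t u)) (Add (Bracket s t) (Bracket s u))"
| bracket_scale_left: "lie_eq (Bracket (Scale c s) t) (Scale c (Bracket s t))"
| bracket_scale_right: "lie_eq (Bracket s (Scale c t)) (Scale c (Bracket s t))"
| bracket_self: "lie_eq (Bracket s s) Zero"
| jacobi: "lie_eq (Add (Add (Bracket s (Bracket t u)) (Bracket t (Bracket u s)))
                    (Bracket u (Bracket s t))) Zero"

quotient_type 'x flie = "'x lie_term" / lie_eq
  by (intro equivpI reflpI sympI transpI) (fact lie_eq.refl lie_eq.sym | erule (1) lie_eq.trans)+

lift_definition flie_gen :: "'x \<Rightarrow> 'x flie" is Gen .
lift_definition flie_zero :: "'x flie" is Zero .
lift_definition flie_add :: "'x flie \<Rightarrow> 'x flie \<Rightarrow> 'x flie" is Add by (rule lie_eq.cong_add)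
lift_definition flie_scale :: "complex \<Rightarrow> 'x flie \<Rightarrow> 'x flie" is Scale by (rule lie_eq.cong_scale)
lift_definition flie_bracket :: "'x flie \<Rightarrow> 'x flie \<Rightarrow> 'x flie" is Bracket
  by (rule lie_eq.cong_bracket)

text \<open>The type \<open>'x flie\<close> is the free Lie algebra on all of \<open>'x\<close>.  The free Lie algebra on
  a set \<open>X\<close> of generators is realised as the Lie subalgebra generated by \<open>X\<close>;
  see \<open>free_lie_universal\<close> below.\<close>

inductive_set flie_carrier :: "'x set \<Rightarrow> 'x flie set" for X :: "'x set" where
  gen: "x \<in> X \<Longrightarrow> flie_gen x \<in> flie_carrier X"
| zero: "flie_zero \<in> flie_carrier X"
| add: "a \<in> flie_carrier X \<Longrightarrow> b \<in> flie_carrier X \<Longrightarrow> flie_add a b \<in> flie_carrier X"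
| scale: "a \<in> flie_carrier X \<Longrightarrow> flie_scale c a \<in> flie_carrier X"
| bracket: "a \<in> flie_carrier X \<Longrightarrow> b \<in> flie_carrier X \<Longrightarrow> flie_bracket a b \<in> flie_carrier X"

definition free_lie :: "'x set \<Rightarrow> 'x flie lie_alg"
  where "free_lie X =
    \<lparr> carrier = flie_carrier X, mult = undefined, one = undefined,
      zero = flie_zero, add = flie_add, smult = flie_scale, bracket = flie_bracket \<rparr>"

definition lie_presented :: "'x set \<Rightarrow> 'x flie set \<Rightarrow> 'x flie set lie_alg"
  where "lie_presented X Rel = lie_quot (free_lie X) (lie_ideal_gen (free_lie X) Rel)"

definition lie_presented_gen :: "'x set \<Rightarrow> 'x flie set \<Rightarrow> 'x \<Rightarrow> 'x flie set"
  where "lie_presented_gen X Rel x = lie_ideal_gen (free_lie X) Rel +>\<^bsub>free_lie X\<^esub> flie_gen x"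


section \<open>The rational holonomy Lie algebra\<close>

definition index_pairs :: "nat set \<Rightarrow> (nat \<times> nat) set"
  where "index_pairs J = {(i, j). i \<in> J \<and> j \<in> J \<and> i < j}"

text \<open>The symmetric generators \<open>t\<^sub>i\<^sub>j = t\<^sub>j\<^sub>i\<close> are indexed by unordered pairs \<open>{i, j}\<close>
  with \<open>i \<noteq> j\<close>.\<close>

definition unordered_pairs :: "nat set \<Rightarrow> nat set set"
  where "unordered_pairs J = {{i, j} |i j. i \<in> J \<and> j \<in> J \<and> i \<noteq> j}"

definition holonomy_relators ::
    "('a, 'm) lie_alg_scheme \<Rightarrow> nat set \<Rightarrow> (nat \<Rightarrow> nat \<Rightarrow> 'a) \<Rightarrow> 'a set"
  where "holonomy_relators L J t =
    {bracket L (t i j) (t i k \<oplus>\<^bsub>L\<^esub> t j k) |i j k. {i, j, k} \<subseteq> J \<and> distinct [i, j, k]} \<union>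
    {bracket L (t i j) (t k l) |i j k l. {i, j, k, l} \<subseteq> J \<and> distinct [i, j, k, l]}"

text \<open>The index \<open>N\<close> is the rank: the Lie algebra of type \<open>A\<^sub>N\<close> has indices \<open>0, \<dots>, N\<close>.\<close>

definition rat_gens :: "nat \<Rightarrow> nat set set"
  where "rat_gens N = unordered_pairs {0..N}"

definition rat_relators :: "nat \<Rightarrow> nat set flie set"
  where "rat_relators N =
    holonomy_relators (free_lie (rat_gens N)) {0..N} (\<lambda>i j. flie_gen {i, j})"

definition rat_holonomy :: "nat \<Rightarrow> nat set flie set lie_alg"
  where "rat_holonomy N = lie_presented (rat_gens N) (rat_relators N)"

definition rat_t :: "nat \<Rightarrow> nat \<Rightarrow> nat \<Rightarrow> nat set flie set"
  where "rat_t N i j = lie_presented_gen (rat_gens N) (rat_relators N) {i, j}"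

definition rat_central :: "nat \<Rightarrow> nat set flie set"
  where "rat_central N =
    finsum (rat_holonomy N) (\<lambda>(i, j). rat_t N i j) (index_pairs {0..N})"

definition rat_central_ideal :: "nat \<Rightarrow> nat set flie set set"
  where "rat_central_ideal N = lie_ideal_gen (rat_holonomy N) {rat_central N}"

definition gaudin_H :: "nat \<Rightarrow> (nat \<Rightarrow> complex) \<Rightarrow> (nat \<Rightarrow> complex) \<Rightarrow> nat set flie set"
  where "gaudin_H N h \<chi> = finsum (rat_holonomy N)
    (\<lambda>(i, j). ((h i - h j) / (\<chi> i - \<chi> j)) \<odot>\<^bsub>rat_holonomy N\<^esub> rat_t N i j) (index_pairs {0..N})"

text \<open>The case \<open>h = \<chi>\<close> shows that every Gaudin subspace contains the central element.\<close>

definition gaudin_subspace :: "nat \<Rightarrow> (nat \<Rightarrow> complex) \<Rightarrow> nat set flie set set"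
  where "gaudin_subspace N \<chi> = lin_span (rat_holonomy N) (range (\<lambda>h. gaudin_H N h \<chi>))"


section \<open>The root system, the torus and its Lie algebra\<close>

text \<open>Roots of type \<open>A\<^sub>n\<close> are integer vectors indexed by \<open>1, \<dots>, n + 1\<close>, extended by zero.\<close>

definition root_vec :: "nat \<Rightarrow> nat \<Rightarrow> nat \<Rightarrow> int"
  where "root_vec i j = (\<lambda>k. of_bool (k = i) - of_bool (k = j))"

definition root_lattice :: "nat \<Rightarrow> (nat \<Rightarrow> int) set"
  where "root_lattice n =
    {(\<lambda>k. \<Sum>(i, j)\<in>index_pairs {1..n+1}. c (i, j) * root_vec i j k) |c. True}"

definition cartan :: "nat \<Rightarrow> ((nat \<Rightarrow> int) \<Rightarrow> complex) set"
  where "cartan n = {h \<in> extensional (root_lattice n).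
    \<forall>\<alpha>\<in>root_lattice n. \<forall>\<beta>\<in>root_lattice n. h (\<lambda>k. \<alpha> k + \<beta> k) = h \<alpha> + h \<beta>}"

definition cartan_add :: "nat \<Rightarrow> ((nat \<Rightarrow> int) \<Rightarrow> complex) \<Rightarrow> ((nat \<Rightarrow> int) \<Rightarrow> complex) \<Rightarrow>
    (nat \<Rightarrow> int) \<Rightarrow> complex"
  where "cartan_add n h h' = restrict (\<lambda>\<alpha>. h \<alpha> + h' \<alpha>) (root_lattice n)"

definition cartan_scale :: "nat \<Rightarrow> complex \<Rightarrow> ((nat \<Rightarrow> int) \<Rightarrow> complex) \<Rightarrow> (nat \<Rightarrow> int) \<Rightarrow> complex"
  where "cartan_scale n c h = restrict (\<lambda>\<alpha>. c * h \<alpha>) (root_lattice n)"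

definition torus :: "nat \<Rightarrow> ((nat \<Rightarrow> int) \<Rightarrow> complex) set"
  where "torus n = {C \<in> extensional (root_lattice n).
    (\<forall>\<alpha>\<in>root_lattice n. C \<alpha> \<noteq> 0) \<and>
    (\<forall>\<alpha>\<in>root_lattice n. \<forall>\<beta>\<in>root_lattice n. C (\<lambda>k. \<alpha> k + \<beta> k) = C \<alpha> * C \<beta>)}"

text \<open>The class of \<open>diag (z\<^sub>1, \<dots>, z\<^sub>n\<^sub>+\<^sub>1)\<close> modulo scalars, as a character of the root lattice.
  The character \<open>e\<^sup>\<alpha>\<close> of the torus is evaluation at \<open>\<alpha>\<close>.\<close>

definition torus_diag :: "nat \<Rightarrow> (nat \<Rightarrow> complex) \<Rightarrow> (nat \<Rightarrow> int) \<Rightarrow> complex"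
  where "torus_diag n z = restrict (\<lambda>\<alpha>. \<Prod>k\<in>{1..n+1}. z k powi \<alpha> k) (root_lattice n)"

definition torus_reg :: "nat \<Rightarrow> ((nat \<Rightarrow> int) \<Rightarrow> complex) set"
  where "torus_reg n = {C \<in> torus n. \<exists>z. (\<forall>i\<in>{1..n+1}. z i \<noteq> 0) \<and> inj_on z {1..n+1} \<and>
    C = torus_diag n z}"


section \<open>The trigonometric holonomy Lie algebra\<close>

datatype trig_gen =
    TGen "nat set"
  | TauGen "(nat \<Rightarrow> int) \<Rightarrow> complex"

definition trig_gens :: "nat \<Rightarrow> trig_gen set"
  where "trig_gens n = TGen ` unordered_pairs {1..n+1} \<union> TauGen ` cartan n"

definition trig_delta :: "('a, 'm) lie_alg_scheme \<Rightarrow> nat \<Rightarrow> (nat \<Rightarrow> nat \<Rightarrow> 'a) \<Rightarrow>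
    (((nat \<Rightarrow> int) \<Rightarrow> complex) \<Rightarrow> 'a) \<Rightarrow> ((nat \<Rightarrow> int) \<Rightarrow> complex) \<Rightarrow> 'a"
  where "trig_delta L n t \<tau> h = \<tau> h \<ominus>\<^bsub>L\<^esub> (1 / 2) \<odot>\<^bsub>L\<^esub>
    finsum L (\<lambda>(i, j). h (root_vec i j) \<odot>\<^bsub>L\<^esub> t i j) (index_pairs {1..n+1})"

definition trig_relators_of :: "('a, 'm) lie_alg_scheme \<Rightarrow> nat \<Rightarrow> (nat \<Rightarrow> nat \<Rightarrow> 'a) \<Rightarrow>
    (((nat \<Rightarrow> int) \<Rightarrow> complex) \<Rightarrow> 'a) \<Rightarrow> 'a set"
  where "trig_relators_of L n t \<tau> =
    holonomy_relators L {1..n+1} t \<union>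
    {\<tau> (cartan_add n h h') \<ominus>\<^bsub>L\<^esub> (\<tau> h \<oplus>\<^bsub>L\<^esub> \<tau> h') |h h'. h \<in> cartan n \<and> h' \<in> cartan n} \<union>
    {\<tau> (cartan_scale n c h) \<ominus>\<^bsub>L\<^esub> c \<odot>\<^bsub>L\<^esub> \<tau> h |c h. h \<in> cartan n} \<union>
    {bracket L (\<tau> h) (\<tau> h') |h h'. h \<in> cartan n \<and> h' \<in> cartan n} \<union>
    {bracket L (t i j) (trig_delta L n t \<tau> h) |i j h.
       i \<in> {1..n+1} \<and> j \<in> {1..n+1} \<and> i \<noteq> j \<and> h \<in> cartan n \<and> h (root_vec i j) = 0}"

definition trig_relators :: "nat \<Rightarrow> trig_gen flie set"
  where "trig_relators n = trig_relators_of (free_lie (trig_gens n)) n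
    (\<lambda>i j. flie_gen (TGen {i, j})) (\<lambda>h. flie_gen (TauGen h))"

definition trig_holonomy :: "nat \<Rightarrow> trig_gen flie set lie_alg"
  where "trig_holonomy n = lie_presented (trig_gens n) (trig_relators n)"

definition trig_t :: "nat \<Rightarrow> nat \<Rightarrow> nat \<Rightarrow> trig_gen flie set"
  where "trig_t n i j = lie_presented_gen (trig_gens n) (trig_relators n) (TGen {i, j})"

definition trig_tau :: "nat \<Rightarrow> ((nat \<Rightarrow> int) \<Rightarrow> complex) \<Rightarrow> trig_gen flie set"
  where "trig_tau n h = lie_presented_gen (trig_gens n) (trig_relators n) (TauGen h)"

definition trig_gen_space :: "nat \<Rightarrow> trig_gen flie set set"
  where "trig_gen_space n = lin_span (trig_holonomy n)
    ({trig_t n i j |i j. i \<in> {1..n+1} \<and> j \<in> {1..n+1} \<and> i \<noteq> j} \<union> trig_tau n ` cartan n)"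

definition bethe_BH ::
    "nat \<Rightarrow> ((nat \<Rightarrow> int) \<Rightarrow> complex) \<Rightarrow> ((nat \<Rightarrow> int) \<Rightarrow> complex) \<Rightarrow> trig_gen flie set"
  where "bethe_BH n C h = trig_tau n h \<ominus>\<^bsub>trig_holonomy n\<^esub>
    finsum (trig_holonomy n)
      (\<lambda>(i, j). (C (root_vec i j) * h (root_vec i j) / (C (root_vec i j) - 1)) \<odot>\<^bsub>trig_holonomy n\<^esub> trig_t n i j)
      (index_pairs {1..n+1})"

definition bethe_subspace :: "nat \<Rightarrow> ((nat \<Rightarrow> int) \<Rightarrow> complex) \<Rightarrow> trig_gen flie set set"
  where "bethe_subspace n C = lin_span (trig_holonomy n) (bethe_BH n C ` cartan n)"


section \<open>Basic facts\<close>

lemma CC_simps [simp]: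
  "carrier CC = UNIV" "x \<otimes>\<^bsub>CC\<^esub> y = x * y" "x \<oplus>\<^bsub>CC\<^esub> y = x + y" "\<one>\<^bsub>CC\<^esub> = 1" "\<zero>\<^bsub>CC\<^esub> = 0"
  by (simp_all add: CC_def)

lemma cring_CC: "cring CC"
proof (rule cringI)
  show "abelian_group CC"
  proof (rule abelian_groupI)
    fix x :: complex
    show "\<exists>y\<in>carrier CC. y \<oplus>\<^bsub>CC\<^esub> x = \<zero>\<^bsub>CC\<^esub>"
      by (intro bexI[of _ "- x"]) simp_all
  qed simp_all
  show "comm_monoid CC"
    by (rule comm_monoidI) simp_all
qed (simp add: distrib_right)

lemma free_lie_simps [simp]:
  "carrier (free_lie X) = flie_carrier X" "\<zero>\<^bsub>free_lie X\<^esub> = flie_zero"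
  "x \<oplus>\<^bsub>free_lie X\<^esub> y = flie_add x y" "c \<odot>\<^bsub>free_lie X\<^esub> x = flie_scale c x"
  "bracket (free_lie X) x y = flie_bracket x y"
  by (simp_all add: free_lie_def)

lemma flie_laws:
  "flie_add (flie_add a b) c = flie_add a (flie_add b c)"
  "flie_add a b = flie_add b a"
  "flie_add flie_zero a = a"
  "flie_add (flie_scale (-1) a) a = flie_zero"
  "flie_scale p (flie_add a b) = flie_add (flie_scale p a) (flie_scale p b)"
  "flie_scale (p + q) a = flie_add (flie_scale p a) (flie_scale q a)"
  "flie_scale (p * q) a = flie_scale p (flie_scale q a)"
  "flie_scale 1 a = a"
  "flie_bracket (flie_add a b) c = flie_add (flie_bracket a c) (flie_bracket b c)"
  "flie_bracket a (flie_add b c) = flie_add (flie_bracket a b) (flie_bracket a c)"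
  "flie_bracket (flie_scale p a) b = flie_scale p (flie_bracket a b)"
  "flie_bracket a (flie_scale p b) = flie_scale p (flie_bracket a b)"
  "flie_bracket a a = flie_zero"
  "flie_add (flie_add (flie_bracket a (flie_bracket b c)) (flie_bracket b (flie_bracket c a)))
     (flie_bracket c (flie_bracket a b)) = flie_zero"
  by (transfer, fact lie_eq.add_assoc lie_eq.add_comm lie_eq.add_zero lie_eq.add_neg lie_eq.scale_add
    lie_eq.add_scale lie_eq.scale_scale lie_eq.scale_one lie_eq.bracket_add_left
    lie_eq.bracket_add_right lie_eq.bracket_scale_left lie_eq.bracket_scale_right
    lie_eq.bracket_self lie_eq.jacobi)+

lemma lie_algebra_free_lie: "lie_algebra (free_lie X)"
proof -
  have "cring CC"
    by (rule cring_CC)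
  moreover have "abelian_group (free_lie X)"
  proof (rule abelian_groupI)
    fix x assume "x \<in> carrier (free_lie X)"
    then show "\<exists>y\<in>carrier (free_lie X). y \<oplus>\<^bsub>free_lie X\<^esub> x = \<zero>\<^bsub>free_lie X\<^esub>"
      by (auto intro!: bexI[of _ "flie_scale (-1) x"] flie_carrier.intros flie_laws(4))
  next
    fix x y show "x \<oplus>\<^bsub>free_lie X\<^esub> y = y \<oplus>\<^bsub>free_lie X\<^esub> x"
      by (simp add: flie_laws(2))
  qed (auto simp: flie_laws(1,3) intro: flie_carrier.intros)
  ultimately have "module CC (free_lie X)"
    by (rule moduleI) (auto simp: flie_laws(5-8) intro: flie_carrier.intros)
  then show ?thesis
    by (intro lie_algebra.intro lie_algebra_axioms.intro)
       (auto simp: flie_laws(9-14) intro: flie_carrier.intros)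
qed

primrec (in lie_algebra) lie_eval :: "('x \<Rightarrow> 'a) \<Rightarrow> 'x lie_term \<Rightarrow> 'a" where
  "lie_eval f (Gen x) = f x"
| "lie_eval f Zero = \<zero>"
| "lie_eval f (Add s t) = lie_eval f s \<oplus> lie_eval f t"
| "lie_eval f (Scale c s) = c \<odot> lie_eval f s"
| "lie_eval f (Bracket s t) = bracket L (lie_eval f s) (lie_eval f t)"

context lie_algebra
begin

lemma lie_eval_closed:
  assumes "\<And>x. f x \<in> carrier L"
  shows "lie_eval f t \<in> carrier L"
  by (induction t) (simp_all add: assms bracket_closed)

lemma lie_eval_eq:
  assumes "lie_eq s t" and f: "\<And>x. f x \<in> carrier L"
  shows "lie_eval f s = lie_eval f t"
proof -
  note [simp] = lie_eval_closed[OF f]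
  note J = jacobi
  have laws: "(-1) \<odot> x \<oplus> x = \<zero>" "(c + d) \<odot> x = c \<odot> x \<oplus> d \<odot> x"
    "(c * d) \<odot> x = c \<odot> (d \<odot> x)" "1 \<odot> x = x" if "x \<in> carrier L" for c d x
    using that smult_l_distr[of "-1" 1 x] smult_l_distr[of c d x] smult_assoc1[of c d x]
      smult_one[of x] smult_l_null[of x] by simp_all
  show ?thesis
    using assms(1)
  proof induction
    case (trans s t u)
    then show ?case by simp
  next
    case (add_comm s t)
    then show ?case by (simp add: a_comm)
  next
    case (jacobi s t u)
    then show ?case by (simp add: J)
  qed (simp_all add: a_assoc smult_r_distr laws bracket_add_left
    bracket_add_right bracket_smult_left bracket_smult_right bracket_self bracket_closed)
qed

end

lemma free_lie_universal:
  fixes L :: "('a, 'm) lie_alg_scheme" and X :: "'x set"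
  assumes "lie_algebra L" and f: "f \<in> X \<rightarrow> carrier L"
  shows "\<exists>F\<in>lie_hom (free_lie X) L. \<forall>x\<in>X. F (flie_gen x) = f x"
    and "\<lbrakk>F \<in> lie_hom (free_lie X) L; F' \<in> lie_hom (free_lie X) L;
          \<And>x. x \<in> X \<Longrightarrow> F (flie_gen x) = F' (flie_gen x); a \<in> flie_carrier X\<rbrakk> \<Longrightarrow> F a = F' a"
proof -
  interpret lie_algebra L by fact
  define f' where "f' x = (if x \<in> X then f x else \<zero>\<^bsub>L\<^esub>)" for x
  have f': "f' x \<in> carrier L" for x using f by (auto simp: f'_def)
  define F where "F a = lie_eval f' (rep_flie a)" for a
  have F_abs: "F (abs_flie t) = lie_eval f' t" for t
    unfolding F_def
  proof (rule lie_eval_eq[OF _ f'])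
    show "lie_eq (rep_flie (abs_flie t)) t"
      using flie.abs_eq_iff Quotient3_abs_rep[OF Quotient3_flie] by blast
  qed
  have F: "F (flie_gen x) = f' x" "F flie_zero = \<zero>\<^bsub>L\<^esub>" "F (flie_add a b) = F a \<oplus>\<^bsub>L\<^esub> F b"
    "F (flie_scale c a) = c \<odot>\<^bsub>L\<^esub> F a" "F (flie_bracket a b) = bracket L (F a) (F b)" for x a b c
  proof -
    have "a = abs_flie (rep_flie a)" "b = abs_flie (rep_flie b)"
      by (simp_all add: Quotient3_abs_rep[OF Quotient3_flie])
    then obtain s t where "a = abs_flie s" "b = abs_flie t"
      by blast
    then show "F (flie_gen x) = f' x" "F flie_zero = \<zero>\<^bsub>L\<^esub>" "F (flie_add a b) = F a \<oplus>\<^bsub>L\<^esub> F b"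
      "F (flie_scale c a) = c \<odot>\<^bsub>L\<^esub> F a" "F (flie_bracket a b) = bracket L (F a) (F b)"
      by (simp_all add: F_abs flie_gen.abs_eq flie_zero.abs_eq flie_add.abs_eq flie_scale.abs_eq
          flie_bracket.abs_eq)
  qed
  have "F a \<in> carrier L" for a
    unfolding F_def by (rule lie_eval_closed[OF f'])
  then show "\<exists>F\<in>lie_hom (free_lie X) L. \<forall>x\<in>X. F (flie_gen x) = f x"
    by (intro bexI[of _ F]) (simp_all add: lie_hom_def F f'_def)
next
  interpret lie_algebra L by fact
  assume F: "F \<in> lie_hom (free_lie X) L" "F' \<in> lie_hom (free_lie X) L"
    and eq: "\<And>x. x \<in> X \<Longrightarrow> F (flie_gen x) = F' (flie_gen x)" and a: "a \<in> flie_carrier X"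
  have zero: "G flie_zero = \<zero>\<^bsub>L\<^esub>" if "G \<in> lie_hom (free_lie X) L" for G
  proof -
    have "G flie_zero \<in> carrier L" "G (flie_scale 0 flie_zero) = 0 \<odot>\<^bsub>L\<^esub> G flie_zero"
      using that by (auto simp: lie_hom_def flie_carrier.zero)
    moreover have "flie_scale 0 flie_zero = (flie_zero :: 'x flie)"
      using module.smult_r_null[of CC "free_lie UNIV" 0] lie_algebra.axioms(1)[OF lie_algebra_free_lie[of UNIV]]
      by simp
    ultimately show ?thesis using smult_l_null by simp
  qed
  show "F a = F' a"
    using a by induction (use F in \<open>auto simp: eq zero, auto simp: lie_hom_def\<close>)
qed

lemma lie_ideal_lie_ideal_gen:
  assumes "lie_algebra L" and "S \<subseteq> carrier L"
  shows "lie_ideal (lie_ideal_gen L S) L"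
proof -
  interpret lie_algebra L by fact
  have sub: "submodule I CC L" if "lie_ideal I L" for I
    using that by (simp add: lie_ideal_def)
  have whole: "lie_ideal (carrier L) L"
    unfolding lie_ideal_def by (auto intro!: submoduleI bracket_closed)
  note E = submoduleE[OF sub]
  have smult: "c \<odot>\<^bsub>L\<^esub> x \<in> I" if "lie_ideal I L" "x \<in> I" for I c x
    using E(4)[OF that(1)] that(2) by simp
  have zero: "\<zero>\<^bsub>L\<^esub> \<in> I" if "lie_ideal I L" for I
    using subgroup.one_closed[OF submodule.axioms(1)[OF sub[OF that]]] by simp
  have "submodule (lie_ideal_gen L S) CC L"
    by (rule submoduleI)
       (use whole assms(2) in \<open>auto simp: lie_ideal_gen_def intro: zero smult E(3,5)\<close>)
  then show ?thesis
    unfolding lie_ideal_def by (auto simp: lie_ideal_gen_def lie_ideal_def)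
qed

lemma lie_algebra_lie_quot:
  assumes "lie_algebra L" and I: "lie_ideal I L"
  shows "lie_algebra (lie_quot L I)"
proof -
  interpret lie_algebra L by fact
  have sub: "submodule I CC L" and br: "\<And>x y. \<lbrakk>x \<in> carrier L; y \<in> I\<rbrakk> \<Longrightarrow> bracket L x y \<in> I"
    using I by (auto simp: lie_ideal_def)
  interpret abelian_subgroup I L
    by (rule abelian_subgroupI3)
       (auto intro: additive_subgroup.intro submodule.axioms(1) sub M.abelian_group_axioms)
  have IL: "I \<subseteq> carrier L" by (rule a_subset)
  have smI: "c \<odot>\<^bsub>L\<^esub> x \<in> I" if "x \<in> I" for c x
    using submoduleE(4)[OF sub] that by simp
  have bracket_skew: "bracket L x y = \<ominus>\<^bsub>L\<^esub> bracket L y x" if "x \<in> carrier L" "y \<in> carrier L" for x y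
  proof -
    have "bracket L (x \<oplus>\<^bsub>L\<^esub> y) (x \<oplus>\<^bsub>L\<^esub> y) =
        (bracket L x x \<oplus>\<^bsub>L\<^esub> bracket L y x) \<oplus>\<^bsub>L\<^esub> (bracket L x y \<oplus>\<^bsub>L\<^esub> bracket L y y)"
      by (simp only: that M.a_closed bracket_add_left bracket_add_right bracket_closed)
    then have "bracket L x y \<oplus>\<^bsub>L\<^esub> bracket L y x = \<zero>\<^bsub>L\<^esub>"
      using that by (simp add: bracket_self bracket_closed M.a_comm)
    then show ?thesis using that by (simp add: bracket_closed M.minus_equality)
  qed
  have br': "bracket L y x \<in> I" if "x \<in> carrier L" "y \<in> I" for x y
    using bracket_skew[of y x] br[OF that] that IL a_inv_closed by auto
  have eqI: "I +>\<^bsub>L\<^esub> (i \<oplus>\<^bsub>L\<^esub> a) = I +>\<^bsub>L\<^esub> a" if "i \<in> I" "a \<in> carrier L" for i a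
    using a_repr_independence[of "i \<oplus>\<^bsub>L\<^esub> a" I a] that by (auto simp: a_r_coset_def' a_subgroup)
  have mem: "x \<in> I +>\<^bsub>L\<^esub> a \<longleftrightarrow> (\<exists>i\<in>I. x = i \<oplus>\<^bsub>L\<^esub> a)" for x a
    by (auto simp: a_r_coset_def')
  let ?Q = "lie_quot L I"
  have carr: "carrier ?Q = (\<lambda>a. I +>\<^bsub>L\<^esub> a) ` carrier L"
    by (auto simp: lie_quot_def A_RCOSETS_def')
  have zero: "\<zero>\<^bsub>?Q\<^esub> = I +>\<^bsub>L\<^esub> \<zero>\<^bsub>L\<^esub>"
    by (simp add: lie_quot_def IL)
  have add: "(I +>\<^bsub>L\<^esub> a) \<oplus>\<^bsub>?Q\<^esub> (I +>\<^bsub>L\<^esub> b) = I +>\<^bsub>L\<^esub> (a \<oplus>\<^bsub>L\<^esub> b)" if "a \<in> carrier L" "b \<in> carrier L" for a b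
    using that by (simp add: lie_quot_def a_rcos_sum)
  have self: "a \<in> I +>\<^bsub>L\<^esub> a" if "a \<in> carrier L" for a
    using that by (rule a_rcos_self)
  have smult: "c \<odot>\<^bsub>?Q\<^esub> (I +>\<^bsub>L\<^esub> a) = I +>\<^bsub>L\<^esub> (c \<odot>\<^bsub>L\<^esub> a)" if "a \<in> carrier L" for c a
  proof -
    have "I +>\<^bsub>L\<^esub> (c \<odot>\<^bsub>L\<^esub> x) = I +>\<^bsub>L\<^esub> (c \<odot>\<^bsub>L\<^esub> a)" if x: "x \<in> I +>\<^bsub>L\<^esub> a" for x
      using x \<open>a \<in> carrier L\<close> IL smI by (auto simp: mem smult_r_distr eqI subset_iff)
    then have "(\<Union>x\<in>I +>\<^bsub>L\<^esub> a. I +>\<^bsub>L\<^esub> (c \<odot>\<^bsub>L\<^esub> x)) = I +>\<^bsub>L\<^esub> (c \<odot>\<^bsub>L\<^esub> a)"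
      using self[OF that] by blast
    then show ?thesis by (simp add: lie_quot_def)
  qed
  have bracket: "bracket ?Q (I +>\<^bsub>L\<^esub> a) (I +>\<^bsub>L\<^esub> b) = I +>\<^bsub>L\<^esub> bracket L a b"
    if ab: "a \<in> carrier L" "b \<in> carrier L" for a b
  proof -
    have "I +>\<^bsub>L\<^esub> bracket L x y = I +>\<^bsub>L\<^esub> bracket L a b" if xy: "x \<in> I +>\<^bsub>L\<^esub> a" "y \<in> I +>\<^bsub>L\<^esub> b" for x y
    proof -
      obtain i j where ij: "i \<in> I" "j \<in> I" "x = i \<oplus>\<^bsub>L\<^esub> a" "y = j \<oplus>\<^bsub>L\<^esub> b"
        using xy by (auto simp: mem)
      then have c: "i \<in> carrier L" "j \<in> carrier L" using IL by auto
      have "bracket L x y = bracket L (i \<oplus>\<^bsub>L\<^esub> a) j \<oplus>\<^bsub>L\<^esub> (bracket L i b \<oplus>\<^bsub>L\<^esub> bracket L a b)"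
        using c ab by (simp add: ij(3,4) bracket_add_left bracket_add_right bracket_closed)
      then show ?thesis
        using c ab ij(1,2) by (simp add: eqI bracket_closed br br')
    qed
    then have "(\<Union>x\<in>I +>\<^bsub>L\<^esub> a. \<Union>y\<in>I +>\<^bsub>L\<^esub> b. I +>\<^bsub>L\<^esub> bracket L x y) = I +>\<^bsub>L\<^esub> bracket L a b"
      using self[OF ab(1)] self[OF ab(2)] by blast
    then show ?thesis by (simp add: lie_quot_def)
  qed
  have "abelian_group ?Q"
  proof (rule abelian_groupI)
    fix x assume "x \<in> carrier ?Q"
    then obtain a where a: "a \<in> carrier L" "x = I +>\<^bsub>L\<^esub> a" by (auto simp: carr)
    then show "\<exists>y\<in>carrier ?Q. y \<oplus>\<^bsub>?Q\<^esub> x = \<zero>\<^bsub>?Q\<^esub>"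
      by (auto simp: carr zero add M.l_neg intro!: bexI[of _ "\<ominus>\<^bsub>L\<^esub> a"])
  qed (auto simp: carr zero add M.a_assoc, simp_all add: M.a_comm)
  then have "module CC ?Q"
    by (intro moduleI cring_CC)
       (use smult_l_distr smult_r_distr smult_assoc1 smult_one in \<open>auto simp: carr smult add\<close>)
  then show ?thesis
    by (intro lie_algebra.intro lie_algebra_axioms.intro)
       (auto simp: carr zero add smult bracket bracket_closed bracket_add_left bracket_add_right
         bracket_smult_left bracket_smult_right bracket_self jacobi)
qed

lemma lie_algebra_lie_presented:
  assumes "Rel \<subseteq> flie_carrier X"
  shows "lie_algebra (lie_presented X Rel)"
  unfolding lie_presented_def
  by (intro lie_algebra_lie_quot lie_algebra_free_lie lie_ideal_lie_ideal_gen) (use assms in simp)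

lemma root_vec_in_root_lattice:
  assumes "i \<in> {1..n+1}" "j \<in> {1..n+1}" "i \<noteq> j"
  shows "root_vec i j \<in> root_lattice n"
proof -
  have fin: "finite (index_pairs {1..n+1})"
    by (rule finite_subset[of _ "{1..n+1} \<times> {1..n+1}"]) (auto simp: index_pairs_def)
  define p where "p = (min i j, max i j)"
  define c where "c q = (if q = p then (if i < j then 1 else -1 :: int) else 0)" for q
  have p: "p \<in> index_pairs {1..n+1}"
    using assms by (auto simp: p_def index_pairs_def min_def max_def)
  have "root_vec i j k = (\<Sum>(i, j)\<in>index_pairs {1..n+1}. c (i, j) * root_vec i j k)" for k
  proof -
    have "(\<Sum>(i, j)\<in>index_pairs {1..n+1}. c (i, j) * root_vec i j k) =
        (\<Sum>q\<in>index_pairs {1..n+1}. if q = p then c p * root_vec (fst p) (snd p) k else 0)"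
      by (rule sum.cong) (auto simp: c_def)
    also have "\<dots> = root_vec i j k"
      using fin p assms(3) by (auto simp: sum.delta c_def p_def root_vec_def min_def max_def)
    finally show ?thesis ..
  qed
  then show ?thesis
    by (auto simp: root_lattice_def)
qed

lemma torus_diag_root:
  assumes "i \<in> {1..n+1}" "j \<in> {1..n+1}" "i \<noteq> j"
  shows "torus_diag n z (root_vec i j) = z i / z j"
proof -
  have "(\<Prod>k\<in>{1..n+1}. z k powi root_vec i j k) =
      (\<Prod>k\<in>{1..n+1}. (if k = i then z i else 1) * (if k = j then inverse (z j) else 1))"
    using assms(3) by (intro prod.cong) (auto simp: root_vec_def)
  also have "\<dots> = z i / z j"
    using assms by (simp add: prod.distrib prod.delta divide_inverse)
  finally show ?thesis
    using root_vec_in_root_lattice[OF assms] by (simp add: torus_diag_def)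
qed

lemma root_lattice_add:
  assumes "\<alpha> \<in> root_lattice n" "\<beta> \<in> root_lattice n"
  shows "(\<lambda>k. \<alpha> k + \<beta> k) \<in> root_lattice n"
proof -
  obtain c d where "\<alpha> = (\<lambda>k. \<Sum>(i, j)\<in>index_pairs {1..n+1}. c (i, j) * root_vec i j k)"
    "\<beta> = (\<lambda>k. \<Sum>(i, j)\<in>index_pairs {1..n+1}. d (i, j) * root_vec i j k)"
    using assms by (auto simp: root_lattice_def)
  then have "(\<lambda>k. \<alpha> k + \<beta> k) =
      (\<lambda>k. \<Sum>(i, j)\<in>index_pairs {1..n+1}. (\<lambda>q. c q + d q) (i, j) * root_vec i j k)"
    by (simp add: sum.distrib[symmetric] case_prod_unfold distrib_right)
  then show ?thesis
    unfolding root_lattice_def by (intro CollectI exI[of _ "\<lambda>q. c q + d q"] conjI TrueI)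
qed

lemma torus_diag_in_torus:
  assumes "\<And>i. i \<in> {1..n+1} \<Longrightarrow> z i \<noteq> 0"
  shows "torus_diag n z \<in> torus n"
proof -
  have "(\<Prod>k\<in>{1..n+1}. z k powi (\<alpha> k + \<beta> k)) =
      (\<Prod>k\<in>{1..n+1}. z k powi \<alpha> k) * (\<Prod>k\<in>{1..n+1}. z k powi \<beta> k)" for \<alpha> \<beta>
    unfolding prod.distrib[symmetric] by (intro prod.cong) (use assms in \<open>auto simp: power_int_add\<close>)
  then show ?thesis
    using assms unfolding torus_def torus_diag_def by (auto simp: root_lattice_add)
qed

end

theory Submission
  imports Defs
begin

text \<open>The homomorphism sends \<open>t\<^sub>i\<^sub>j\<close> to \<open>t\<^sub>i\<^sub>j\<close> and \<open>\<tau>(h)\<close> to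
  \<open>- \<Sum>\<^sub>j h\<^sub>j J\<^sub>j\<close>, where \<open>J\<^sub>j = \<Sum>\<^sub>i\<^sub><\<^sub>j t\<^sub>i\<^sub>j\<close> are the Jucys--Murphy elements and
  \<open>h\<^sub>j = h(\<epsilon>\<^sub>j - \<epsilon>\<^sub>1)\<close>, that is, the diagonal matrix \<open>h\<close> is normalised by \<open>h\<^sub>1 = 0\<close>.
  Changing the normalisation changes the image of \<open>\<tau>(h)\<close> by a multiple of \<open>\<Sum>\<^sub>j J\<^sub>j\<close>, the sum
  of all \<open>t\<^sub>i\<^sub>j\<close>.  The formula is read off from the third assertion: with
  \<open>\<chi> = diag (0, z)\<close> and \<open>g\<^sub>i = \<chi>\<^sub>i h\<^sub>i\<close>,
  \<open>(g\<^sub>i - g\<^sub>j) / (\<chi>\<^sub>i - \<chi>\<^sub>j) = z\<^sub>i (h\<^sub>i - h\<^sub>j) / (z\<^sub>i - z\<^sub>j) + h\<^sub>j\<close> for \<open>1 \<le> i < j\<close>,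
  and for \<open>i = 0\<close> the quotient is \<open>h\<^sub>j\<close>, so \<open>BH(C, h)\<close> goes to \<open>- H(g, \<chi>)\<close>.

  The defining relations hold in the image by one principle, \<open>bracket_t_pair_comb\<close>: if \<open>c\<close> is
  symmetric and \<open>c\<^sub>a\<^sub>m = c\<^sub>b\<^sub>m\<close> for all \<open>m\<close> other than \<open>a, b\<close>, then \<open>t\<^sub>a\<^sub>b\<close> commutes with
  \<open>\<Sum> c\<^sub>i\<^sub>j t\<^sub>i\<^sub>j\<close>.  It gives the commutativity of the \<open>J\<^sub>j\<close>, hence of the \<open>\<tau>(h)\<close>, and it
  gives the relation for \<open>\<delta>(h)\<close>, because \<open>\<delta>(h)\<close> goes to the combination with coefficients
  \<open>- (h\<^sub>i + h\<^sub>j) / 2\<close> at \<open>i, j \<ge> 1\<close> and \<open>- h\<^sub>j\<close> at \<open>0, j\<close>.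

  Everything else is linear algebra in the span of the \<open>t\<^sub>i\<^sub>j\<close>, which are linearly independent:
  the relators are brackets, so any assignment of scalars to the generators extends to a homomorphism
  into the one-dimensional abelian Lie algebra (\<open>rat_coefficient_functional\<close>).  The coefficient of
  \<open>t\<^sub>0\<^sub>j\<close> recovers \<open>h\<^sub>j\<close>, which gives injectivity on the generators.  Modulo the central
  element the coefficient of \<open>t\<^sub>0\<^sub>1\<close> can be made \<open>0\<close>, and every combination without
  \<open>t\<^sub>0\<^sub>1\<close> is in the image; this gives surjectivity.  Finally \<open>H(\<chi>, \<chi>)\<close> is the central
  element, and modulo constants and multiples of \<open>\<chi>\<close> every \<open>g\<close> has \<open>g\<^sub>0 = g\<^sub>1 = 0\<close>, so that
  \<open>g\<^sub>i = \<chi>\<^sub>i h\<^sub>i\<close> for some \<open>h\<close> with \<open>h\<^sub>1 = 0\<close>;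
  so the Gaudin subspace is the direct sum of the image of the Bethe subspace and the central line.\<close>

section \<open>Homomorphisms, quotients and presentations\<close>

lemma lie_homD:
  assumes "F \<in> lie_hom L M"
  shows "x \<in> carrier L \<Longrightarrow> F x \<in> carrier M"
    and "\<lbrakk>x \<in> carrier L; y \<in> carrier L\<rbrakk> \<Longrightarrow> F (x \<oplus>\<^bsub>L\<^esub> y) = F x \<oplus>\<^bsub>M\<^esub> F y"
    and "x \<in> carrier L \<Longrightarrow> F (c \<odot>\<^bsub>L\<^esub> x) = c \<odot>\<^bsub>M\<^esub> F x"
    and "\<lbrakk>x \<in> carrier L; y \<in> carrier L\<rbrakk> \<Longrightarrow> F (bracket L x y) = bracket M (F x) (F y)"
  using assms by (auto simp: lie_hom_def)

lemma lie_hom_comp: "\<lbrakk>F \<in> lie_hom K L; G \<in> lie_hom L M\<rbrakk> \<Longrightarrow> G \<circ> F \<in> lie_hom K M"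
  by (auto simp: lie_hom_def Pi_iff)

context lie_algebra
begin

lemma smult_mem [simp]: "x \<in> carrier L \<Longrightarrow> c \<odot> x \<in> carrier L"
  by simp

lemma smult_scalars [simp]:
  assumes "x \<in> carrier L"
  shows "0 \<odot> x = \<zero>" "1 \<odot> x = x" "c \<odot> (d \<odot> x) = (c * d) \<odot> x" "c \<odot> \<zero> = \<zero>"
    and smult_add_left: "(c + d) \<odot> x = c \<odot> x \<oplus> d \<odot> x"
  using assms smult_l_null[of x] smult_one[of x] smult_assoc1[of c d x] smult_l_distr[of c d x]
  by simp_all

lemma uminus_eq_smult: "x \<in> carrier L \<Longrightarrow> \<ominus> x = (-1) \<odot> x"
  using smult_add_left[of x "-1" 1] by (intro M.minus_equality) simp_all

lemma minus_eq_add_smult: "\<lbrakk>x \<in> carrier L; y \<in> carrier L\<rbrakk> \<Longrightarrow> x \<ominus> y = x \<oplus> (-1) \<odot> y"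
  by (simp add: a_minus_def uminus_eq_smult)

lemma minus_eq_zero: "\<lbrakk>x \<in> carrier L; y \<in> carrier L; x \<ominus> y = \<zero>\<rbrakk> \<Longrightarrow> x = y"
  using M.minus_equality[of x "\<ominus> y"] by (simp add: a_minus_def)

lemma bracket_zero:
  "x \<in> carrier L \<Longrightarrow> bracket L x \<zero> = \<zero>" "x \<in> carrier L \<Longrightarrow> bracket L \<zero> x = \<zero>"
  using bracket_smult_right[of x \<zero> 0] bracket_smult_left[of \<zero> x 0]
  by (simp_all add: bracket_closed)

lemma submoduleI_smult:
  assumes "H \<subseteq> carrier L" "\<zero> \<in> H" "\<And>x y. \<lbrakk>x \<in> H; y \<in> H\<rbrakk> \<Longrightarrow> x \<oplus> y \<in> H"
    "\<And>c x. x \<in> H \<Longrightarrow> c \<odot> x \<in> H"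
  shows "submodule H CC L"
  using assms by (intro submoduleI) (auto simp: uminus_eq_smult subset_iff)

lemma submodule_mem:
  assumes "submodule H CC L"
  shows "x \<in> H \<Longrightarrow> x \<in> carrier L" "\<zero> \<in> H" "\<lbrakk>x \<in> H; y \<in> H\<rbrakk> \<Longrightarrow> x \<oplus> y \<in> H"
    "x \<in> H \<Longrightarrow> c \<odot> x \<in> H"
  using submoduleE[OF assms] subgroup.one_closed[OF submodule.axioms(1)[OF assms]] by auto

lemma lin_span_eqI:
  assumes "submodule H CC L" "S \<subseteq> H" "\<And>H'. \<lbrakk>submodule H' CC L; S \<subseteq> H'\<rbrakk> \<Longrightarrow> H \<subseteq> H'"
  shows "lin_span L S = H"
  using assms by (auto simp: lin_span_def)

lemma lin_span_submodule: "submodule H CC L \<Longrightarrow> lin_span L H = H"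
  by (rule lin_span_eqI) auto

lemma lin_span_singleton:
  assumes x: "x \<in> carrier L"
  shows "lin_span L {x} = range (\<lambda>c. c \<odot> x)"
proof (rule lin_span_eqI)
  show "submodule (range (\<lambda>c. c \<odot> x)) CC L"
  proof (rule submoduleI_smult)
    show "range (\<lambda>c. c \<odot> x) \<subseteq> carrier L" using x by auto
    show "\<zero> \<in> range (\<lambda>c. c \<odot> x)" by (rule range_eqI[of _ _ 0]) (use x smult_l_null in simp)
    fix u v c assume "u \<in> range (\<lambda>c. c \<odot> x)" "v \<in> range (\<lambda>c. c \<odot> x)"
    then obtain a b where "u = a \<odot> x" "v = b \<odot> x" by auto
    then have "u \<oplus> v = (a + b) \<odot> x" using x smult_l_distr[of a b x] by simp
    then show "u \<oplus> v \<in> range (\<lambda>c. c \<odot> x)" by blast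
  next
    fix u c assume "u \<in> range (\<lambda>c. c \<odot> x)"
    then obtain a where "u = a \<odot> x" by auto
    then have "c \<odot> u = (c * a) \<odot> x" using x smult_assoc1[of c a x] by simp
    then show "c \<odot> u \<in> range (\<lambda>c. c \<odot> x)" by blast
  qed
  show "{x} \<subseteq> range (\<lambda>c. c \<odot> x)" using smult_one[OF x] by (auto intro!: range_eqI[of _ _ 1])
qed (use submodule_mem(4) in auto)

lemma finsum_mem_submodule:
  assumes H: "submodule H CC L" and f: "\<And>i. i \<in> A \<Longrightarrow> f i \<in> H"
  shows "finsum L f A \<in> H"
  using f
proof (induction A rule: infinite_finite_induct)
  case (insert a A)
  then have "f \<in> A \<rightarrow> carrier L" "f a \<in> carrier L" using submodule_mem(1)[OF H] by auto
  then show ?case using insert submodule_mem[OF H] by simp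
qed (use submodule_mem(2)[OF H] in simp_all)

lemma bracket_finsum_right:
  assumes "x \<in> carrier L" "f \<in> A \<rightarrow> carrier L"
  shows "bracket L x (finsum L f A) = finsum L (\<lambda>i. bracket L x (f i)) A"
  using assms(2)
proof (induction A rule: infinite_finite_induct)
  case (insert a A)
  then have "f \<in> A \<rightarrow> carrier L" "f a \<in> carrier L"
    "(\<lambda>i. bracket L x (f i)) \<in> A \<rightarrow> carrier L" using assms(1) by (auto intro: bracket_closed)
  then show ?case using insert assms(1) by (simp add: bracket_add_right bracket_closed)
qed (simp_all add: assms(1) bracket_zero)

lemma bracket_skew:
  assumes "x \<in> carrier L" "y \<in> carrier L"
  shows "bracket L x y = \<ominus> bracket L y x"
proof -
  have "bracket L (x \<oplus> y) (x \<oplus> y) =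
      (bracket L x x \<oplus> bracket L y x) \<oplus> (bracket L x y \<oplus> bracket L y y)"
    by (simp only: assms M.a_closed bracket_add_left bracket_add_right bracket_closed)
  then have "bracket L x y \<oplus> bracket L y x = \<zero>"
    using assms by (simp add: bracket_self bracket_closed M.a_comm)
  then show ?thesis using assms by (simp add: bracket_closed M.minus_equality)
qed

lemma bracket_eq_zero_commute:
  "\<lbrakk>x \<in> carrier L; y \<in> carrier L; bracket L x y = \<zero>\<rbrakk> \<Longrightarrow> bracket L y x = \<zero>"
  using bracket_skew[of y x] by simp

lemma submodule_centralizer:
  assumes S: "S \<subseteq> carrier L"
  shows "submodule {y \<in> carrier L. \<forall>x\<in>S. bracket L x y = \<zero>} CC L"
  using S by (intro submoduleI_smult)
    (auto simp: subset_iff bracket_zero bracket_add_right bracket_smult_right)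

end

lemma lie_hom_zero:
  assumes "lie_algebra L" "lie_algebra M" "F \<in> lie_hom L M"
  shows "F \<zero>\<^bsub>L\<^esub> = \<zero>\<^bsub>M\<^esub>"
proof -
  interpret L: lie_algebra L by fact
  interpret M: lie_algebra M by fact
  have "F (0 \<odot>\<^bsub>L\<^esub> \<zero>\<^bsub>L\<^esub>) = 0 \<odot>\<^bsub>M\<^esub> F \<zero>\<^bsub>L\<^esub>" by (rule lie_homD[OF assms(3)]) simp
  then show ?thesis using lie_homD(1)[OF assms(3), of "\<zero>\<^bsub>L\<^esub>"] L.smult_l_null M.smult_l_null by simp
qed

lemma lie_hom_minus:
  assumes "lie_algebra L" "lie_algebra M" "F \<in> lie_hom L M" "x \<in> carrier L" "y \<in> carrier L"
  shows "F (x \<ominus>\<^bsub>L\<^esub> y) = F x \<ominus>\<^bsub>M\<^esub> F y"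
proof -
  interpret L: lie_algebra L by fact
  interpret M: lie_algebra M by fact
  show ?thesis
    using assms(4,5) lie_homD[OF assms(3)] by (simp add: L.minus_eq_add_smult M.minus_eq_add_smult)
qed

lemma lie_hom_finsum:
  assumes "lie_algebra L" "lie_algebra M" "F \<in> lie_hom L M" and f: "f \<in> A \<rightarrow> carrier L"
  shows "F (finsum L f A) = finsum M (\<lambda>i. F (f i)) A"
proof -
  interpret L: lie_algebra L by fact
  interpret M: lie_algebra M by fact
  note F = lie_homD[OF assms(3)]
  show ?thesis using f
  proof (induction A rule: infinite_finite_induct)
    case (insert a A)
    then have "f \<in> A \<rightarrow> carrier L" "f a \<in> carrier L" "(\<lambda>i. F (f i)) \<in> A \<rightarrow> carrier M" "F (f a) \<in> carrier M"
      using F(1) by auto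
    then show ?case using insert F by simp
  qed (simp_all add: lie_hom_zero[OF assms(1-3)])
qed

lemma lie_ideal_kernel:
  assumes "lie_algebra L" "lie_algebra M" "F \<in> lie_hom L M"
  shows "lie_ideal {x \<in> carrier L. F x = \<zero>\<^bsub>M\<^esub>} L"
proof -
  interpret L: lie_algebra L by fact
  interpret M: lie_algebra M by fact
  note F = lie_homD[OF assms(3)]
  show ?thesis unfolding lie_ideal_def
  proof
    show "submodule {x \<in> carrier L. F x = \<zero>\<^bsub>M\<^esub>} CC L"
      by (rule L.submoduleI_smult) (auto simp: F lie_hom_zero[OF assms])
  qed (auto simp: F L.bracket_closed M.bracket_zero)
qed

lemma
  assumes "lie_algebra L" and I: "lie_ideal I L"
  shows carrier_lie_quot: "carrier (lie_quot L I) = (\<lambda>a. I +>\<^bsub>L\<^esub> a) ` carrier L"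
    and lie_hom_lie_quot: "(\<lambda>a. I +>\<^bsub>L\<^esub> a) \<in> lie_hom L (lie_quot L I)"
    and lie_coset_eq_iff:
      "\<lbrakk>a \<in> carrier L; b \<in> carrier L\<rbrakk> \<Longrightarrow> I +>\<^bsub>L\<^esub> a = I +>\<^bsub>L\<^esub> b \<longleftrightarrow> a \<ominus>\<^bsub>L\<^esub> b \<in> I"
proof -
  interpret lie_algebra L by fact
  have sub: "submodule I CC L" and br: "\<And>x y. \<lbrakk>x \<in> carrier L; y \<in> I\<rbrakk> \<Longrightarrow> bracket L x y \<in> I"
    using I by (auto simp: lie_ideal_def)
  note smem = submodule_mem[OF sub]
  interpret abelian_subgroup I L
    by (rule abelian_subgroupI3)
       (auto intro: additive_subgroup.intro submodule.axioms(1) sub M.abelian_group_axioms)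
  have br': "bracket L y x \<in> I" if "x \<in> carrier L" "y \<in> I" for x y
    using bracket_skew[of y x] br[OF that] that smem by (simp add: uminus_eq_smult bracket_closed)
  have mem: "x \<in> I +>\<^bsub>L\<^esub> a \<longleftrightarrow> (\<exists>i\<in>I. x = i \<oplus>\<^bsub>L\<^esub> a)" for x a
    by (auto simp: a_r_coset_def')
  have eqI: "I +>\<^bsub>L\<^esub> (i \<oplus>\<^bsub>L\<^esub> a) = I +>\<^bsub>L\<^esub> a" if "i \<in> I" "a \<in> carrier L" for i a
    using a_repr_independence[of "i \<oplus>\<^bsub>L\<^esub> a" I a] that by (auto simp: mem a_subgroup)
  let ?Q = "lie_quot L I"
  show carr: "carrier ?Q = (\<lambda>a. I +>\<^bsub>L\<^esub> a) ` carrier L"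
    by (auto simp: lie_quot_def A_RCOSETS_def')
  have self: "a \<in> I +>\<^bsub>L\<^esub> a" if "a \<in> carrier L" for a
    using that by (rule a_rcos_self)
  have smult: "c \<odot>\<^bsub>?Q\<^esub> (I +>\<^bsub>L\<^esub> a) = I +>\<^bsub>L\<^esub> (c \<odot>\<^bsub>L\<^esub> a)" if "a \<in> carrier L" for c a
  proof -
    have "I +>\<^bsub>L\<^esub> (c \<odot>\<^bsub>L\<^esub> x) = I +>\<^bsub>L\<^esub> (c \<odot>\<^bsub>L\<^esub> a)" if x: "x \<in> I +>\<^bsub>L\<^esub> a" for x
      using x \<open>a \<in> carrier L\<close> smem by (auto simp: mem smult_r_distr eqI)
    then have "(\<Union>x\<in>I +>\<^bsub>L\<^esub> a. I +>\<^bsub>L\<^esub> (c \<odot>\<^bsub>L\<^esub> x)) = I +>\<^bsub>L\<^esub> (c \<odot>\<^bsub>L\<^esub> a)"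
      using self[OF that] by blast
    then show ?thesis by (simp add: lie_quot_def)
  qed
  have bracket: "bracket ?Q (I +>\<^bsub>L\<^esub> a) (I +>\<^bsub>L\<^esub> b) = I +>\<^bsub>L\<^esub> bracket L a b"
    if ab: "a \<in> carrier L" "b \<in> carrier L" for a b
  proof -
    have "I +>\<^bsub>L\<^esub> bracket L x y = I +>\<^bsub>L\<^esub> bracket L a b" if xy: "x \<in> I +>\<^bsub>L\<^esub> a" "y \<in> I +>\<^bsub>L\<^esub> b" for x y
    proof -
      obtain i j where ij: "i \<in> I" "j \<in> I" "x = i \<oplus>\<^bsub>L\<^esub> a" "y = j \<oplus>\<^bsub>L\<^esub> b"
        using xy by (auto simp: mem)
      then have c: "i \<in> carrier L" "j \<in> carrier L" using smem by auto
      have "bracket L x y = bracket L (i \<oplus>\<^bsub>L\<^esub> a) j \<oplus>\<^bsub>L\<^esub> (bracket L i b \<oplus>\<^bsub>L\<^esub> bracket L a b)"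
        using c ab by (simp add: ij(3,4) bracket_add_left bracket_add_right bracket_closed)
      then show ?thesis
        using c ab ij(1,2) by (simp add: eqI bracket_closed br br')
    qed
    then have "(\<Union>x\<in>I +>\<^bsub>L\<^esub> a. \<Union>y\<in>I +>\<^bsub>L\<^esub> b. I +>\<^bsub>L\<^esub> bracket L x y) = I +>\<^bsub>L\<^esub> bracket L a b"
      using self[OF ab(1)] self[OF ab(2)] by blast
    then show ?thesis by (simp add: lie_quot_def)
  qed
  show "(\<lambda>a. I +>\<^bsub>L\<^esub> a) \<in> lie_hom L ?Q"
    unfolding lie_hom_def using carr by (simp add: smult bracket Pi_iff, simp add: lie_quot_def a_rcos_sum)
  show "I +>\<^bsub>L\<^esub> a = I +>\<^bsub>L\<^esub> b \<longleftrightarrow> a \<ominus>\<^bsub>L\<^esub> b \<in> I" if ab: "a \<in> carrier L" "b \<in> carrier L"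
  proof -
    have eq: "a = (a \<ominus>\<^bsub>L\<^esub> b) \<oplus>\<^bsub>L\<^esub> b" using ab by (simp add: a_minus_def M.a_assoc M.l_neg)
    show ?thesis
    proof
      assume "I +>\<^bsub>L\<^esub> a = I +>\<^bsub>L\<^esub> b"
      then obtain i where i: "i \<in> I" "a = i \<oplus>\<^bsub>L\<^esub> b" using self[OF ab(1)] mem by auto
      then show "a \<ominus>\<^bsub>L\<^esub> b \<in> I" using ab smem(1)[OF i(1)] by (simp add: a_minus_def M.a_assoc M.r_neg)
    next
      assume "a \<ominus>\<^bsub>L\<^esub> b \<in> I"
      then show "I +>\<^bsub>L\<^esub> a = I +>\<^bsub>L\<^esub> b" using eqI[OF _ ab(2)] eq by metis
    qed
  qed
qed

text \<open>The map induced on the quotient is computed on an arbitrary representative of each coset.\<close>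

lemma lie_quot_universal:
  assumes L: "lie_algebra L" and I: "lie_ideal I L" and M: "lie_algebra M"
    and F: "F \<in> lie_hom L M" and zero: "\<And>x. x \<in> I \<Longrightarrow> F x = \<zero>\<^bsub>M\<^esub>"
  shows "\<exists>G\<in>lie_hom (lie_quot L I) M. \<forall>a\<in>carrier L. G (I +>\<^bsub>L\<^esub> a) = F a"
proof -
  interpret L: lie_algebra L by fact
  interpret M: lie_algebra M by fact
  note \<pi> = lie_homD(2-4)[OF lie_hom_lie_quot[OF L I]] and F' = lie_homD[OF F]
  define G where "G A = F (SOME a. a \<in> carrier L \<and> I +>\<^bsub>L\<^esub> a = A)" for A
  have G: "G (I +>\<^bsub>L\<^esub> a) = F a" if a: "a \<in> carrier L" for a
  proof -
    define b where "b = (SOME b. b \<in> carrier L \<and> I +>\<^bsub>L\<^esub> b = I +>\<^bsub>L\<^esub> a)"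
    have b: "b \<in> carrier L \<and> I +>\<^bsub>L\<^esub> b = I +>\<^bsub>L\<^esub> a"
      unfolding b_def by (rule someI[of _ a]) (use a in auto)
    then have "F (b \<ominus>\<^bsub>L\<^esub> a) = \<zero>\<^bsub>M\<^esub>" using zero lie_coset_eq_iff[OF L I] a by blast
    then have "F b \<ominus>\<^bsub>M\<^esub> F a = \<zero>\<^bsub>M\<^esub>" using a b by (simp add: lie_hom_minus[OF L M F])
    then have "F b = F a" using a b F'(1) M.minus_eq_zero by simp
    then show ?thesis by (simp add: G_def b_def)
  qed
  have "G \<in> lie_hom (lie_quot L I) M"
    unfolding lie_hom_def
    by (auto simp: carrier_lie_quot[OF L I] G F' \<pi>[symmetric] L.bracket_closed)
  then show ?thesis using G by blast
qed

lemma lie_hom_lie_presented: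
  assumes Rel: "Rel \<subseteq> flie_carrier X"
  shows "(\<lambda>a. lie_ideal_gen (free_lie X) Rel +>\<^bsub>free_lie X\<^esub> a) \<in> lie_hom (free_lie X) (lie_presented X Rel)"
    and "carrier (lie_presented X Rel) =
      (\<lambda>a. lie_ideal_gen (free_lie X) Rel +>\<^bsub>free_lie X\<^esub> a) ` flie_carrier X"
    and "r \<in> Rel \<Longrightarrow> lie_ideal_gen (free_lie X) Rel +>\<^bsub>free_lie X\<^esub> r = \<zero>\<^bsub>lie_presented X Rel\<^esub>"
proof -
  have I: "lie_ideal (lie_ideal_gen (free_lie X) Rel) (free_lie X)"
    by (rule lie_ideal_lie_ideal_gen[OF lie_algebra_free_lie]) (use Rel in simp)
  note L = lie_algebra_free_lie[of X]
  interpret lie_algebra "free_lie X" by fact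
  show hom: "(\<lambda>a. lie_ideal_gen (free_lie X) Rel +>\<^bsub>free_lie X\<^esub> a) \<in> lie_hom (free_lie X) (lie_presented X Rel)"
    unfolding lie_presented_def by (rule lie_hom_lie_quot[OF L I])
  show "carrier (lie_presented X Rel) =
      (\<lambda>a. lie_ideal_gen (free_lie X) Rel +>\<^bsub>free_lie X\<^esub> a) ` flie_carrier X"
    unfolding lie_presented_def by (simp add: carrier_lie_quot[OF L I])
  show "lie_ideal_gen (free_lie X) Rel +>\<^bsub>free_lie X\<^esub> r = \<zero>\<^bsub>lie_presented X Rel\<^esub>" if r: "r \<in> Rel"
  proof -
    have r': "r \<in> carrier (free_lie X)" using Rel r by auto
    have "r \<in> lie_ideal_gen (free_lie X) Rel" using r by (auto simp: lie_ideal_gen_def)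
    then have "r \<ominus>\<^bsub>free_lie X\<^esub> \<zero>\<^bsub>free_lie X\<^esub> \<in> lie_ideal_gen (free_lie X) Rel"
      using r' M.r_zero[of r] by (simp add: minus_eq_add_smult del: free_lie_simps)
    then have "lie_ideal_gen (free_lie X) Rel +>\<^bsub>free_lie X\<^esub> r
        = lie_ideal_gen (free_lie X) Rel +>\<^bsub>free_lie X\<^esub> \<zero>\<^bsub>free_lie X\<^esub>"
      using lie_coset_eq_iff[OF L I r' M.zero_closed] by blast
    then show ?thesis using lie_hom_zero[OF L lie_algebra_lie_presented[OF Rel] hom] by simp
  qed
qed

lemma lie_presented_gen_carrier:
  "\<lbrakk>Rel \<subseteq> flie_carrier X; x \<in> X\<rbrakk> \<Longrightarrow> lie_presented_gen X Rel x \<in> carrier (lie_presented X Rel)"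
  by (auto simp: lie_hom_lie_presented lie_presented_gen_def intro: flie_carrier.gen)

text \<open>The hypothesis on \<open>F\<close> says that the relators evaluate to zero in \<open>M\<close>; it is stated for an
  arbitrary homomorphic extension \<open>F\<close> of \<open>f\<close> so that no particular extension has to be named.\<close>

lemma lie_presented_universal:
  assumes Rel: "Rel \<subseteq> flie_carrier X" and M: "lie_algebra M" and f: "f \<in> X \<rightarrow> carrier M"
    and zero: "\<And>F r. \<lbrakk>F \<in> lie_hom (free_lie X) M; \<And>x. x \<in> X \<Longrightarrow> F (flie_gen x) = f x; r \<in> Rel\<rbrakk>
      \<Longrightarrow> F r = \<zero>\<^bsub>M\<^esub>"
  shows "\<exists>G\<in>lie_hom (lie_presented X Rel) M. \<forall>x\<in>X. G (lie_presented_gen X Rel x) = f x"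
proof -
  note L = lie_algebra_free_lie[of X]
  have I: "lie_ideal (lie_ideal_gen (free_lie X) Rel) (free_lie X)"
    by (rule lie_ideal_lie_ideal_gen[OF L]) (use Rel in simp)
  obtain F where F: "F \<in> lie_hom (free_lie X) M" "\<And>x. x \<in> X \<Longrightarrow> F (flie_gen x) = f x"
    using free_lie_universal(1)[OF M f] by auto
  have "lie_ideal_gen (free_lie X) Rel \<subseteq> {x \<in> carrier (free_lie X). F x = \<zero>\<^bsub>M\<^esub>}"
    using lie_ideal_kernel[OF L M F(1)] zero[OF F] Rel by (auto simp: lie_ideal_gen_def)
  then obtain G where "G \<in> lie_hom (lie_presented X Rel) M"
      "\<forall>a\<in>carrier (free_lie X). G (lie_ideal_gen (free_lie X) Rel +>\<^bsub>free_lie X\<^esub> a) = F a"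
    unfolding lie_presented_def using lie_quot_universal[OF L I M F(1)] by blast
  then show ?thesis
    using F(2) by (intro bexI[of _ G]) (simp_all add: lie_presented_gen_def flie_carrier.gen)
qed

lemma lie_presented_induct [consumes 2, case_names gen zero add smult bracket]:
  assumes Rel: "Rel \<subseteq> flie_carrier X" and y: "y \<in> carrier (lie_presented X Rel)"
    and gen: "\<And>x. x \<in> X \<Longrightarrow> P (lie_presented_gen X Rel x)"
    and zero: "P \<zero>\<^bsub>lie_presented X Rel\<^esub>"
    and add: "\<And>x y. \<lbrakk>x \<in> carrier (lie_presented X Rel); y \<in> carrier (lie_presented X Rel); P x; P y\<rbrakk>
      \<Longrightarrow> P (x \<oplus>\<^bsub>lie_presented X Rel\<^esub> y)"
    and smult: "\<And>c x. \<lbrakk>x \<in> carrier (lie_presented X Rel); P x\<rbrakk> \<Longrightarrow> P (c \<odot>\<^bsub>lie_presented X Rel\<^esub> x)"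
    and bracket: "\<And>x y. \<lbrakk>x \<in> carrier (lie_presented X Rel); y \<in> carrier (lie_presented X Rel); P x; P y\<rbrakk>
      \<Longrightarrow> P (bracket (lie_presented X Rel) x y)"
  shows "P y"
proof -
  define \<pi> where "\<pi> = (\<lambda>a. lie_ideal_gen (free_lie X) Rel +>\<^bsub>free_lie X\<^esub> a)"
  have hom: "\<pi> \<in> lie_hom (free_lie X) (lie_presented X Rel)"
    and carr: "carrier (lie_presented X Rel) = \<pi> ` flie_carrier X"
    and gen': "\<And>x. x \<in> X \<Longrightarrow> P (\<pi> (flie_gen x))"
    using lie_hom_lie_presented[OF Rel] gen by (auto simp: \<pi>_def lie_presented_gen_def)
  note \<pi>_hom = lie_homD[OF hom, unfolded free_lie_simps]
  have \<pi>_zero: "\<pi> flie_zero = \<zero>\<^bsub>lie_presented X Rel\<^esub>"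
    using lie_hom_zero[OF lie_algebra_free_lie lie_algebra_lie_presented[OF Rel] hom] by simp
  have "P (\<pi> a)" if "a \<in> flie_carrier X" for a
    using that by induction (auto simp: \<pi>_hom \<pi>_zero carr intro!: gen' zero add smult bracket)
  then show ?thesis using y by (auto simp: carr)
qed


section \<open>Linear combinations of the generators\<close>

definition pair_comb ::
    "('a, 'm) lie_alg_scheme \<Rightarrow> nat set \<Rightarrow> (nat \<Rightarrow> nat \<Rightarrow> 'a) \<Rightarrow> (nat \<Rightarrow> nat \<Rightarrow> complex) \<Rightarrow> 'a"
  where "pair_comb L J t c = finsum L (\<lambda>(i, j). c i j \<odot>\<^bsub>L\<^esub> t i j) (index_pairs J)"

lemma finite_index_pairs: "finite J \<Longrightarrow> finite (index_pairs J)"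
  by (rule finite_subset[of _ "J \<times> J"]) (auto simp: index_pairs_def)

text \<open>The diagonal values \<open>t i i\<close> are unconstrained, since the sums run over pairs \<open>i < j\<close>.\<close>

locale pair_family = lie_algebra L for L :: "('a, 'm) lie_alg_scheme" (structure) +
  fixes J :: "nat set" and t :: "nat \<Rightarrow> nat \<Rightarrow> 'a"
  assumes finite_J: "finite J"
    and t_closed: "\<lbrakk>i \<in> J; j \<in> J; i \<noteq> j\<rbrakk> \<Longrightarrow> t i j \<in> carrier L"
begin

lemma summand_closed: "(\<lambda>(i, j). c i j \<odot> t i j) \<in> index_pairs J \<rightarrow> carrier L"
  by (auto simp: index_pairs_def t_closed)

lemma pair_comb_closed: "pair_comb L J t c \<in> carrier L"
  unfolding pair_comb_def by (rule M.finsum_closed[OF summand_closed])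

lemma pair_comb_cong:
  assumes "\<And>i j. \<lbrakk>i \<in> J; j \<in> J; i < j\<rbrakk> \<Longrightarrow> c i j = d i j"
  shows "pair_comb L J t c = pair_comb L J t d"
  unfolding pair_comb_def
  by (rule M.finsum_cong'[OF HOL.refl summand_closed]) (auto simp: index_pairs_def assms)

lemma pair_comb_add:
  "pair_comb L J t c \<oplus> pair_comb L J t d = pair_comb L J t (\<lambda>i j. c i j + d i j)"
  unfolding pair_comb_def M.finsum_addf[OF summand_closed summand_closed, symmetric]
  by (rule M.finsum_cong') (auto simp: index_pairs_def t_closed smult_add_left)

lemma pair_comb_smult: "a \<odot> pair_comb L J t c = pair_comb L J t (\<lambda>i j. a * c i j)"
  unfolding pair_comb_def
  by (subst finsum_smult_ldistr[OF finite_index_pairs[OF finite_J] _ summand_closed], simp)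
     (rule M.finsum_cong', auto simp: index_pairs_def t_closed)

lemma pair_comb_uminus: "\<ominus> pair_comb L J t c = pair_comb L J t (\<lambda>i j. - c i j)"
  by (simp add: uminus_eq_smult pair_comb_closed pair_comb_smult)

lemma pair_comb_minus:
  "pair_comb L J t c \<ominus> pair_comb L J t d = pair_comb L J t (\<lambda>i j. c i j - d i j)"
  by (simp add: a_minus_def pair_comb_uminus pair_comb_add)

lemma pair_comb_zero: "pair_comb L J t (\<lambda>i j. 0) = \<zero>"
  unfolding pair_comb_def by (rule M.add.finprod_one_eqI) (auto simp: index_pairs_def t_closed)

lemma pair_comb_sum:
  "finite A \<Longrightarrow> finsum L (\<lambda>k. pair_comb L J t (c k)) A = pair_comb L J t (\<lambda>i j. \<Sum>k\<in>A. c k i j)"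
  by (induction A rule: finite_induct) (simp_all add: pair_comb_closed pair_comb_zero pair_comb_add)

lemma pair_comb_subset:
  assumes "I \<subseteq> J"
  shows "pair_comb L I t c = pair_comb L J t (\<lambda>i j. if i \<in> I \<and> j \<in> I then c i j else 0)"
  unfolding pair_comb_def
  by (rule M.add.finprod_mono_neutral_cong_left[OF finite_index_pairs[OF finite_J]])
     (use assms in \<open>auto simp: index_pairs_def t_closed subset_iff split: if_splits\<close>)

lemma pair_comb_single:
  assumes "a \<in> J" "b \<in> J" "a < b"
  shows "pair_comb L J t (\<lambda>i j. of_bool (i = a \<and> j = b)) = t a b"
proof -
  have "pair_comb L J t (\<lambda>i j. of_bool (i = a \<and> j = b)) = finsum L (\<lambda>(i, j). t i j) {(a, b)}"
    unfolding pair_comb_def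
    by (rule M.add.finprod_mono_neutral_cong_right[OF finite_index_pairs[OF finite_J]])
       (use assms in \<open>auto simp: index_pairs_def t_closed of_bool_def split: if_splits\<close>)
  then show ?thesis using assms t_closed by simp
qed

end

lemma lie_hom_pair_comb:
  assumes "pair_family L J t" "lie_algebra M" "F \<in> lie_hom L M"
  shows "F (pair_comb L J t c) = pair_comb M J (\<lambda>i j. F (t i j)) c"
proof -
  interpret pair_family L J t by fact
  interpret M': lie_algebra M by fact
  note F = lie_homD[OF assms(3)]
  show ?thesis
    unfolding pair_comb_def lie_hom_finsum[OF lie_algebra_axioms assms(2,3) summand_closed]
    by (rule M'.M.finsum_cong') (auto simp: index_pairs_def t_closed F)
qed


section \<open>Commutation relations\<close>

locale holonomy_family = pair_family +
  assumes t_sym: "t i j = t j i"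
    and relators_zero: "holonomy_relators L J t \<subseteq> {\<zero>}"
begin

lemma bracket_triple:
  "\<lbrakk>i \<in> J; j \<in> J; k \<in> J; distinct [i, j, k]\<rbrakk> \<Longrightarrow> bracket L (t i j) (t i k \<oplus> t j k) = \<zero>"
  using relators_zero unfolding holonomy_relators_def by blast

lemma bracket_disjoint:
  "\<lbrakk>i \<in> J; j \<in> J; k \<in> J; l \<in> J; distinct [i, j, k, l]\<rbrakk> \<Longrightarrow> bracket L (t i j) (t k l) = \<zero>"
  using relators_zero unfolding holonomy_relators_def by blast

text \<open>A summand \<open>t i j\<close> commutes with \<open>t a b\<close> when \<open>{i, j}\<close> is disjoint from \<open>{a, b}\<close> or equal to
  it.  The remaining summands are grouped by the index \<open>m\<close> outside \<open>{a, b}\<close>; as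
  \<open>c a m = c b m\<close>, each group is a multiple of \<open>t a m \<oplus> t b m\<close>, which commutes with \<open>t a b\<close>.\<close>

lemma bracket_t_pair_comb:
  assumes ab: "a \<in> J" "b \<in> J" "a \<noteq> b" and c_sym: "\<And>i j. c i j = c j i"
    and eq: "\<And>m. \<lbrakk>m \<in> J; m \<noteq> a; m \<noteq> b\<rbrakk> \<Longrightarrow> c a m = c b m"
  shows "bracket L (t a b) (pair_comb L J t c) = \<zero>"
proof -
  define f where "f i j = bracket L (t a b) (c i j \<odot> t i j)" for i j
  \<comment> \<open>The pair \<open>{x, m}\<close> in increasing order, as it occurs in the index set of the sum.\<close>
  define p where "p x m = (if x < m then (x, m) else (m, x))" for x m :: nat
  define K where "K = J - {a, b}"
  have tab: "t a b \<in> carrier L" using ab t_closed by blast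
  have f_closed: "f i j \<in> carrier L" if "i \<in> J" "j \<in> J" "i \<noteq> j" for i j
    using that tab by (simp add: f_def bracket_closed t_closed)
  have fp: "case_prod f (p x m) = f x m" for x m
    by (auto simp: p_def f_def c_sym[of m x] t_sym[of m x])
  have p_mem: "p x m \<in> index_pairs J" if "x \<in> J" "m \<in> J" "x \<noteq> m" for x m
    using that by (auto simp: p_def index_pairs_def)
  have f_pi: "case_prod f \<in> index_pairs J \<rightarrow> carrier L"
    by (auto simp: index_pairs_def f_closed)
  have f_zero: "f i j = \<zero>" if "(i, j) \<in> index_pairs J - (p a ` K \<union> p b ` K)" for i j
  proof -
    have ij: "i \<in> J" "j \<in> J" "i < j" using that by (auto simp: index_pairs_def)
    have *: "\<And>x m. \<lbrakk>x = a \<or> x = b; m \<in> K\<rbrakk> \<Longrightarrow> (i, j) \<noteq> p x m" using that by auto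
    consider "{i, j} = {a, b}" | "distinct [a, b, i, j]"
      using *[of i j] *[of j i] ij ab by (auto simp: p_def K_def)
    then show ?thesis
    proof cases
      case 1
      then have "t i j = t a b" using t_sym by (auto simp: doubleton_eq_iff)
      then show ?thesis using tab by (simp add: f_def bracket_smult_right bracket_self)
    next
      case 2
      then show ?thesis using bracket_disjoint[of a b i j] ab ij tab
        by (simp add: f_def bracket_smult_right t_closed)
    qed
  qed
  have fin: "finite K" by (simp add: K_def finite_J)
  have inj: "inj_on (p x) K" for x by (auto simp: inj_on_def p_def split: if_splits)
  have sub: "p a ` K \<union> p b ` K \<subseteq> index_pairs J"
    using ab by (auto intro!: p_mem simp: K_def)
  have p_closed: "case_prod f \<in> p x ` K \<rightarrow> carrier L" if "x = a \<or> x = b" for x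
    using sub f_pi that by blast
  have disj: "p a ` K \<inter> p b ` K = {}"
    using ab by (auto simp: p_def K_def split: if_splits)
  have "bracket L (t a b) (pair_comb L J t c) = finsum L (case_prod f) (index_pairs J)"
    unfolding pair_comb_def bracket_finsum_right[OF tab summand_closed]
    by (rule M.finsum_cong'[OF HOL.refl f_pi]) (auto simp: f_def)
  also have "\<dots> = finsum L (case_prod f) (p a ` K \<union> p b ` K)"
    by (rule M.add.finprod_mono_neutral_cong_right[OF finite_index_pairs[OF finite_J] sub])
       (use f_zero f_pi in auto)
  also have "\<dots> = finsum L (case_prod f) (p a ` K) \<oplus> finsum L (case_prod f) (p b ` K)"
    using fin disj p_closed by (intro M.finsum_Un_disjoint) auto
  also have "\<dots> = finsum L (f a) K \<oplus> finsum L (f b) K"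
  proof -
    have "finsum L (case_prod f) (p x ` K) = finsum L (f x) K" if "x = a \<or> x = b" for x
      using M.finsum_reindex[OF p_closed[OF that] inj] by (simp add: fp)
    then show ?thesis by simp
  qed
  also have "\<dots> = finsum L (\<lambda>m. f a m \<oplus> f b m) K"
    by (rule M.finsum_addf[symmetric]) (use ab in \<open>auto simp: K_def intro!: f_closed\<close>)
  also have "\<dots> = \<zero>"
  proof (rule M.add.finprod_one_eqI)
    fix m assume "m \<in> K"
    then have m: "m \<in> J" "m \<noteq> a" "m \<noteq> b" by (auto simp: K_def)
    then have "f a m \<oplus> f b m = c b m \<odot> bracket L (t a b) (t a m \<oplus> t b m)"
      using ab tab eq[OF m]
      by (simp add: f_def bracket_smult_right bracket_add_right smult_r_distr t_closed bracket_closed)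
    then show "f a m \<oplus> f b m = \<zero>" using bracket_triple[of a b m] ab m by simp
  qed
  finally show ?thesis .
qed

definition jucys_murphy :: "nat \<Rightarrow> 'a"
  where "jucys_murphy l = pair_comb L J t (\<lambda>i j. of_bool (max i j = l))"

text \<open>For \<open>i < k < l\<close> the coefficients of \<open>J\<^sub>l\<close> do not distinguish \<open>i\<close> from \<open>k\<close>, so \<open>t i k\<close>
  commutes with \<open>J\<^sub>l\<close>; and \<open>J\<^sub>k\<close> is a sum of such \<open>t i k\<close>.\<close>

lemma jucys_murphy_commute_less:
  assumes "k < l"
  shows "bracket L (jucys_murphy l) (jucys_murphy k) = \<zero>"
proof -
  define H where "H = {y \<in> carrier L. \<forall>x\<in>{jucys_murphy l}. bracket L x y = \<zero>}"
  have JM: "jucys_murphy l \<in> carrier L" by (simp add: jucys_murphy_def pair_comb_closed)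
  have H: "submodule H CC L" unfolding H_def by (rule submodule_centralizer) (use JM in simp)
  have "t i k \<in> H" if "i \<in> J" "k \<in> J" "i < k" for i
  proof -
    have "bracket L (t i k) (jucys_murphy l) = \<zero>" unfolding jucys_murphy_def
      by (rule bracket_t_pair_comb) (use that assms in \<open>auto simp: max_def\<close>)
    then show ?thesis using that t_closed JM bracket_eq_zero_commute by (auto simp: H_def)
  qed
  then have "jucys_murphy k \<in> H"
    unfolding jucys_murphy_def pair_comb_def
    by (intro finsum_mem_submodule[OF H])
       (auto simp: index_pairs_def max_def t_closed intro: submodule_mem[OF H])
  then show ?thesis by (simp add: H_def)
qed

lemma jucys_murphy_commute: "bracket L (jucys_murphy k) (jucys_murphy l) = \<zero>"
proof -
  have JM: "jucys_murphy m \<in> carrier L" for m by (simp add: jucys_murphy_def pair_comb_closed)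
  consider "k < l" | "l < k" | "k = l" by linarith
  then show ?thesis
    by cases (use jucys_murphy_commute_less JM bracket_eq_zero_commute bracket_self in blast)+
qed

text \<open>Coefficients that depend on the larger index alone give linear combinations of the commuting
  Jucys--Murphy elements.\<close>

lemma pair_comb_max_commute:
  "bracket L (pair_comb L J t (\<lambda>i j. u (max i j))) (pair_comb L J t (\<lambda>i j. v (max i j))) = \<zero>"
proof -
  have JM: "jucys_murphy m \<in> carrier L" for m by (simp add: jucys_murphy_def pair_comb_closed)
  have eq: "pair_comb L J t (\<lambda>i j. w (max i j)) = finsum L (\<lambda>k. w k \<odot> jucys_murphy k) J" for w
  proof -
    have "finsum L (\<lambda>k. w k \<odot> jucys_murphy k) J =
        pair_comb L J t (\<lambda>i j. \<Sum>k\<in>J. w k * of_bool (max i j = k))"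
      unfolding jucys_murphy_def pair_comb_smult by (rule pair_comb_sum[OF finite_J])
    also have "\<dots> = pair_comb L J t (\<lambda>i j. w (max i j))"
      by (rule pair_comb_cong) (auto simp: finite_J max_def if_distrib cong: if_cong)
    finally show ?thesis ..
  qed
  define H where "H S = {y \<in> carrier L. \<forall>x\<in>S. bracket L x y = \<zero>}" for S
  have H: "submodule (H S) CC L" if "S \<subseteq> carrier L" for S
    unfolding H_def by (rule submodule_centralizer[OF that])
  have R: "range jucys_murphy \<subseteq> carrier L" using JM by auto
  have comb: "pair_comb L J t (\<lambda>i j. w (max i j)) \<in> H S"
    if "S \<subseteq> carrier L" "\<And>k. jucys_murphy k \<in> H S" for w S
    unfolding eq by (intro finsum_mem_submodule[OF H] submodule_mem(4)[OF H] that)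
  have "pair_comb L J t (\<lambda>i j. u (max i j)) \<in> H (range jucys_murphy)"
    using R by (rule comb) (auto simp: H_def JM jucys_murphy_commute)
  then have u: "pair_comb L J t (\<lambda>i j. u (max i j)) \<in> carrier L"
    "\<And>k. bracket L (pair_comb L J t (\<lambda>i j. u (max i j))) (jucys_murphy k) = \<zero>"
    using JM bracket_eq_zero_commute by (auto simp: H_def)
  have "pair_comb L J t (\<lambda>i j. v (max i j)) \<in> H {pair_comb L J t (\<lambda>i j. u (max i j))}"
    by (rule comb) (use u JM in \<open>auto simp: H_def\<close>)
  then show ?thesis by (simp add: H_def)
qed

end


section \<open>The rational holonomy Lie algebra\<close>

lemma (in lie_algebra) holonomy_relators_closed:
  assumes "\<And>i j. \<lbrakk>i \<in> J; j \<in> J; i \<noteq> j\<rbrakk> \<Longrightarrow> t i j \<in> carrier L"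
  shows "holonomy_relators L J t \<subseteq> carrier L"
  using assms by (auto simp: holonomy_relators_def intro!: bracket_closed)

lemma lie_hom_holonomy_relators:
  assumes "F \<in> lie_hom L M" "lie_algebra L"
    and t: "\<And>i j. \<lbrakk>i \<in> J; j \<in> J; i \<noteq> j\<rbrakk> \<Longrightarrow> t i j \<in> carrier L"
    and t': "\<And>i j. \<lbrakk>i \<in> J; j \<in> J; i \<noteq> j\<rbrakk> \<Longrightarrow> F (t i j) = t' i j"
  shows "F ` holonomy_relators L J t = holonomy_relators M J t'"
proof -
  interpret lie_algebra L by fact
  have 3: "F ` {g i j k |i j k. P i j k} = {g' i j k |i j k. P i j k}"
    if "\<And>i j k. P i j k \<Longrightarrow> F (g i j k) = g' i j k" for g g' and P :: "nat \<Rightarrow> nat \<Rightarrow> nat \<Rightarrow> bool"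
  proof (rule equalityI; clarify)
    fix i j k assume "P i j k"
    then show "g' i j k \<in> F ` {g i j k |i j k. P i j k}"
      by (intro image_eqI[where x = "g i j k"]) (auto simp: that)
  qed (use that in blast)
  have 4: "F ` {g i j k l |i j k l. P i j k l} = {g' i j k l |i j k l. P i j k l}"
    if "\<And>i j k l. P i j k l \<Longrightarrow> F (g i j k l) = g' i j k l"
    for g g' and P :: "nat \<Rightarrow> nat \<Rightarrow> nat \<Rightarrow> nat \<Rightarrow> bool"
  proof (rule equalityI; clarify)
    fix i j k l assume "P i j k l"
    then show "g' i j k l \<in> F ` {g i j k l |i j k l. P i j k l}"
      by (intro image_eqI[where x = "g i j k l"]) (auto simp: that)
  qed (use that in blast)
  show ?thesis
    unfolding holonomy_relators_def image_Un
    by (intro arg_cong2[where f = "(\<union>)"] 3 4) (auto simp: lie_homD[OF assms(1)] t t')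
qed

lemma rat_gen_mem: "\<lbrakk>i \<in> {0..N}; j \<in> {0..N}; i \<noteq> j\<rbrakk> \<Longrightarrow> {i, j} \<in> rat_gens N"
  by (auto simp: rat_gens_def unordered_pairs_def)

lemma rat_relators_closed: "rat_relators N \<subseteq> flie_carrier (rat_gens N)"
proof -
  interpret lie_algebra "free_lie (rat_gens N)" by (rule lie_algebra_free_lie)
  show ?thesis unfolding rat_relators_def free_lie_simps(1)[symmetric]
    by (rule holonomy_relators_closed) (simp add: rat_gen_mem flie_carrier.gen)
qed

lemma lie_algebra_rat_holonomy: "lie_algebra (rat_holonomy N)"
  unfolding rat_holonomy_def by (rule lie_algebra_lie_presented[OF rat_relators_closed])

lemma rat_t_closed: "\<lbrakk>i \<in> {0..N}; j \<in> {0..N}; i \<noteq> j\<rbrakk> \<Longrightarrow> rat_t N i j \<in> carrier (rat_holonomy N)"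
  unfolding rat_t_def rat_holonomy_def
  by (rule lie_presented_gen_carrier[OF rat_relators_closed rat_gen_mem])

lemma holonomy_family_rat: "holonomy_family (rat_holonomy N) {0..N} (rat_t N)"
proof -
  define \<pi> where "\<pi> = (\<lambda>a. lie_ideal_gen (free_lie (rat_gens N)) (rat_relators N) +>\<^bsub>free_lie (rat_gens N)\<^esub> a)"
  have \<pi>: "\<pi> \<in> lie_hom (free_lie (rat_gens N)) (rat_holonomy N)"
    unfolding \<pi>_def rat_holonomy_def by (rule lie_hom_lie_presented[OF rat_relators_closed])
  have "holonomy_relators (rat_holonomy N) {0..N} (rat_t N) = \<pi> ` rat_relators N"
    unfolding rat_relators_def
    by (subst lie_hom_holonomy_relators[OF \<pi> lie_algebra_free_lie, where t' = "rat_t N"])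
       (auto simp: rat_gen_mem flie_carrier.gen \<pi>_def rat_t_def lie_presented_gen_def)
  also have "\<dots> \<subseteq> {\<zero>\<^bsub>rat_holonomy N\<^esub>}"
    using lie_hom_lie_presented(3)[OF rat_relators_closed] by (auto simp: \<pi>_def rat_holonomy_def)
  finally have "holonomy_relators (rat_holonomy N) {0..N} (rat_t N) \<subseteq> {\<zero>\<^bsub>rat_holonomy N\<^esub>}" .
  moreover have "rat_t N i j = rat_t N j i" for i j by (simp add: rat_t_def insert_commute)
  ultimately show ?thesis
    by (intro holonomy_family.intro pair_family.intro lie_algebra_rat_holonomy
        pair_family_axioms.intro holonomy_family_axioms.intro)
       (auto simp: rat_t_closed)
qed

definition abelian_line :: "complex lie_alg"
  where "abelian_line = \<lparr> carrier = UNIV, mult = undefined, one = undefined, zero = 0, add = (+),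
    smult = (*), bracket = (\<lambda>x y. 0) \<rparr>"

lemma abelian_line_simps [simp]:
  "carrier abelian_line = UNIV" "\<zero>\<^bsub>abelian_line\<^esub> = 0" "x \<oplus>\<^bsub>abelian_line\<^esub> y = x + y"
  "c \<odot>\<^bsub>abelian_line\<^esub> x = c * x" "bracket abelian_line x y = 0"
  by (simp_all add: abelian_line_def)

lemma lie_algebra_abelian_line: "lie_algebra abelian_line"
proof -
  have "abelian_group abelian_line"
  proof (rule abelian_groupI)
    fix x :: complex
    show "\<exists>y\<in>carrier abelian_line. y \<oplus>\<^bsub>abelian_line\<^esub> x = \<zero>\<^bsub>abelian_line\<^esub>"
      by (intro bexI[of _ "- x"]) simp_all
  qed simp_all
  then have "module CC abelian_line"
    by (rule moduleI[OF cring_CC]) (simp_all add: algebra_simps)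
  then show ?thesis by (intro lie_algebra.intro lie_algebra_axioms.intro) simp_all
qed

text \<open>All relators are brackets, hence vanish in an abelian Lie algebra whatever the values of the
  generators are.  So the dual basis of the generators extends to the whole Lie algebra.\<close>

lemma rat_coefficient_functional:
  assumes "a < b"
  shows "\<exists>F\<in>lie_hom (rat_holonomy N) abelian_line.
    \<forall>i\<in>{0..N}. \<forall>j\<in>{0..N}. i < j \<longrightarrow> F (rat_t N i j) = of_bool (i = a \<and> j = b)"
proof -
  define f :: "nat set \<Rightarrow> complex" where "f e = of_bool (e = {a, b})" for e
  have "F r = 0" if "F \<in> lie_hom (free_lie (rat_gens N)) abelian_line" "r \<in> rat_relators N" for F r
  proof -
    interpret lie_algebra "free_lie (rat_gens N)" by (rule lie_algebra_free_lie)
    have "F ` rat_relators N = holonomy_relators abelian_line {0..N} (\<lambda>i j. F (flie_gen {i, j}))"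
      unfolding rat_relators_def
      by (rule lie_hom_holonomy_relators[OF that(1) lie_algebra_free_lie])
         (simp_all add: rat_gen_mem flie_carrier.gen)
    also have "\<dots> \<subseteq> {0}" by (auto simp: holonomy_relators_def)
    finally show ?thesis using that(2) by auto
  qed
  then have "\<exists>F\<in>lie_hom (rat_holonomy N) abelian_line.
      \<forall>x\<in>rat_gens N. F (lie_presented_gen (rat_gens N) (rat_relators N) x) = f x"
    unfolding rat_holonomy_def
    by (intro lie_presented_universal[OF rat_relators_closed lie_algebra_abelian_line]) auto
  then obtain F where F: "F \<in> lie_hom (rat_holonomy N) abelian_line"
    "\<And>x. x \<in> rat_gens N \<Longrightarrow> F (lie_presented_gen (rat_gens N) (rat_relators N) x) = f x"
    by blast
  have "{i, j} = {a, b} \<longleftrightarrow> i = a \<and> j = b" if "i < j" for i j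
    using that assms by (auto simp: doubleton_eq_iff)
  then show ?thesis
    using F by (intro bexI[of _ F]) (auto simp: rat_t_def rat_gen_mem f_def)
qed

definition rat_comb :: "nat \<Rightarrow> (nat \<Rightarrow> nat \<Rightarrow> complex) \<Rightarrow> nat set flie set"
  where "rat_comb N c = pair_comb (rat_holonomy N) {0..N} (rat_t N) c"

lemma rat_comb_coefficient:
  assumes "a \<in> {0..N}" "b \<in> {0..N}" "a < b" and eq: "rat_comb N c = rat_comb N d"
  shows "c a b = d a b"
proof -
  interpret R: holonomy_family "rat_holonomy N" "{0..N}" "rat_t N" by (rule holonomy_family_rat)
  obtain F where F: "F \<in> lie_hom (rat_holonomy N) abelian_line"
    "\<And>i j. \<lbrakk>i \<in> {0..N}; j \<in> {0..N}; i < j\<rbrakk> \<Longrightarrow> F (rat_t N i j) = of_bool (i = a \<and> j = b)"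
    using rat_coefficient_functional[OF assms(3)] by blast
  define u where "u i j = (of_bool (i = a \<and> j = b) :: complex)" for i j
  interpret A: pair_family abelian_line "{0..N}" u
    by (intro pair_family.intro pair_family_axioms.intro lie_algebra_abelian_line) auto
  have "F (rat_comb N e) = e a b" for e
  proof -
    have "F (rat_comb N e) = pair_comb abelian_line {0..N} (\<lambda>i j. F (rat_t N i j)) e"
      unfolding rat_comb_def
      by (rule lie_hom_pair_comb[OF R.pair_family_axioms lie_algebra_abelian_line F(1)])
    also have "\<dots> = finsum abelian_line
        (\<lambda>q. if (a, b) = q then case_prod e q else \<zero>\<^bsub>abelian_line\<^esub>) (index_pairs {0..N})"
      unfolding pair_comb_def by (rule A.M.finsum_cong') (auto simp: F(2) index_pairs_def)
    also have "\<dots> = case_prod e (a, b)"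
      by (rule A.M.finsum_singleton) (use assms(1-3) in \<open>simp_all add: finite_index_pairs, simp add: index_pairs_def\<close>)
    also have "\<dots> = e a b" by simp
    finally show ?thesis .
  qed
  then show ?thesis using eq by metis
qed


section \<open>Coordinates on the Cartan subalgebra\<close>

lemma root_vec_add: "(\<lambda>l. root_vec i j l + root_vec j k l) = root_vec i k"
  by (auto simp: root_vec_def)

lemma root_lattice_zero: "(\<lambda>k. 0) \<in> root_lattice n"
  unfolding root_lattice_def by (rule CollectI, rule exI[of _ "\<lambda>q. 0"]) auto

lemma root_vec_mem: "\<lbrakk>i \<in> {1..n+1}; j \<in> {1..n+1}\<rbrakk> \<Longrightarrow> root_vec i j \<in> root_lattice n"
  using root_vec_in_root_lattice[of i n j] root_lattice_zero[of n]
  by (cases "i = j") (auto simp: root_vec_def)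

lemma cartan_plus:
  "\<lbrakk>h \<in> cartan n; \<alpha> \<in> root_lattice n; \<beta> \<in> root_lattice n\<rbrakk> \<Longrightarrow> h (\<lambda>k. \<alpha> k + \<beta> k) = h \<alpha> + h \<beta>"
  by (simp add: cartan_def)

lemma cartan_zero: "h \<in> cartan n \<Longrightarrow> h (\<lambda>k. 0) = 0"
  using cartan_plus[OF _ root_lattice_zero root_lattice_zero, of h n] by simp

lemma cartan_add_mem: "\<lbrakk>h \<in> cartan n; h' \<in> cartan n\<rbrakk> \<Longrightarrow> cartan_add n h h' \<in> cartan n"
  by (simp add: cartan_def cartan_add_def root_lattice_add)

lemma cartan_scale_mem: "h \<in> cartan n \<Longrightarrow> cartan_scale n c h \<in> cartan n"
  by (simp add: cartan_def cartan_scale_def root_lattice_add distrib_left)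

text \<open>The diagonal entries of \<open>h\<close>, a diagonal matrix modulo scalars, in the representative whose first
  entry is \<open>0\<close>.\<close>

definition coord :: "((nat \<Rightarrow> int) \<Rightarrow> complex) \<Rightarrow> nat \<Rightarrow> complex"
  where "coord h j = h (root_vec j 1)"

lemma coord_1: "h \<in> cartan n \<Longrightarrow> coord h 1 = 0"
  using cartan_zero[of h n] by (simp add: coord_def root_vec_def)

lemma cartan_root:
  "\<lbrakk>h \<in> cartan n; i \<in> {1..n+1}; j \<in> {1..n+1}\<rbrakk> \<Longrightarrow> h (root_vec i j) = coord h i - coord h j"
  using cartan_plus[of h n "root_vec i j" "root_vec j 1"]
  by (simp add: root_vec_mem root_vec_add coord_def)

lemma coord_cartan_add: "j \<in> {1..n+1} \<Longrightarrow> coord (cartan_add n h h') j = coord h j + coord h' j"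
  by (simp add: coord_def cartan_add_def root_vec_mem)

lemma coord_cartan_scale: "j \<in> {1..n+1} \<Longrightarrow> coord (cartan_scale n c h) j = c * coord h j"
  by (simp add: coord_def cartan_scale_def root_vec_mem)

lemma cartan_of_coords:
  assumes "v 1 = 0"
  shows "\<exists>h\<in>cartan n. \<forall>j\<in>{1..n+1}. coord h j = v j"
proof -
  define h where "h = restrict (\<lambda>\<alpha>. \<Sum>k\<in>{1..n+1}. v k * of_int (\<alpha> k)) (root_lattice n)"
  have "h \<in> cartan n"
    by (auto simp: cartan_def h_def root_lattice_add distrib_left sum.distrib)
  moreover have "coord h j = v j" if "j \<in> {1..n+1}" for j
  proof -
    have "coord h j = (\<Sum>k\<in>{1..n+1}. (if k = j then v j else 0) - (if k = 1 then v 1 else 0))"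
      using that root_vec_mem[of j n 1]
      by (auto simp: coord_def h_def root_vec_def intro!: sum.cong)
    also have "\<dots> = v j" using that assms by (simp add: sum_subtractf)
    finally show ?thesis .
  qed
  ultimately show ?thesis by blast
qed

text \<open>The set where two additive functions agree is closed under addition, so it contains the lattice once
  it contains the roots.\<close>

lemma cartan_eqI:
  assumes h: "h \<in> cartan n" "h' \<in> cartan n" and eq: "\<And>j. j \<in> {1..n+1} \<Longrightarrow> coord h j = coord h' j"
  shows "h = h'"
proof -
  define D where "D = {\<alpha> \<in> root_lattice n. h \<alpha> = h' \<alpha>}"
  have zero: "(\<lambda>k. 0) \<in> D" using h by (simp add: D_def root_lattice_zero cartan_zero)
  have add: "(\<lambda>k. \<alpha> k + \<beta> k) \<in> D" if "\<alpha> \<in> D" "\<beta> \<in> D" for \<alpha> \<beta>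
    using that h by (simp add: D_def root_lattice_add cartan_plus)
  have root: "root_vec i j \<in> D" if "i \<in> {1..n+1}" "j \<in> {1..n+1}" for i j
    using that h eq by (simp add: D_def root_vec_mem cartan_root)
  have nat_mult: "(\<lambda>k. int m * root_vec i j k) \<in> D" if "i \<in> {1..n+1}" "j \<in> {1..n+1}" for m i j
  proof (induction m)
    case (Suc m)
    from add[OF this root[OF that]] show ?case by (simp add: algebra_simps)
  qed (simp add: zero)
  have mult: "(\<lambda>k. c * root_vec i j k) \<in> D" if "i \<in> {1..n+1}" "j \<in> {1..n+1}" for c i j
  proof (cases "c \<ge> 0")
    case True
    then show ?thesis using nat_mult[OF that, of "nat c"] by simp
  next
    case False
    have "root_vec j i k = - root_vec i j k" for k by (simp add: root_vec_def)
    then show ?thesis using False nat_mult[OF that(2,1), of "nat (- c)"] by simp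
  qed
  have "(\<lambda>k. \<Sum>(i, j)\<in>A. c (i, j) * root_vec i j k) \<in> D" if "A \<subseteq> index_pairs {1..n+1}" for A and c
  proof -
    have "finite A" by (rule finite_subset[OF that]) (simp add: finite_index_pairs)
    then show ?thesis using that
    proof (induction A rule: finite_induct)
      case (insert q A)
      obtain i j where q: "q = (i, j)" by fastforce
      then have "i \<in> {1..n+1}" "j \<in> {1..n+1}" using insert.prems by (auto simp: index_pairs_def)
      from add[OF mult[OF this, of "c q"] insert.IH] insert show ?case by (simp add: q)
    qed (simp_all add: zero)
  qed
  then have "h \<alpha> = h' \<alpha>" if "\<alpha> \<in> root_lattice n" for \<alpha>
    using that by (force simp: root_lattice_def D_def)
  then show ?thesis using h by (auto simp: cartan_def intro: extensionalityI)
qed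


section \<open>The trigonometric holonomy Lie algebra\<close>

lemma (in lie_algebra) trig_delta_closed:
  assumes t: "\<And>i j. \<lbrakk>i \<in> {1..n+1}; j \<in> {1..n+1}; i \<noteq> j\<rbrakk> \<Longrightarrow> t i j \<in> carrier L"
    and \<tau>: "\<tau> h \<in> carrier L"
  shows "trig_delta L n t \<tau> h \<in> carrier L"
  unfolding trig_delta_def using \<tau>
  by (intro M.minus_closed smult_mem M.finsum_closed) (auto simp: index_pairs_def t)

lemma (in lie_algebra) trig_relators_of_closed:
  assumes t: "\<And>i j. \<lbrakk>i \<in> {1..n+1}; j \<in> {1..n+1}; i \<noteq> j\<rbrakk> \<Longrightarrow> t i j \<in> carrier L"
    and \<tau>: "\<And>h. h \<in> cartan n \<Longrightarrow> \<tau> h \<in> carrier L"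
  shows "trig_relators_of L n t \<tau> \<subseteq> carrier L"
  unfolding trig_relators_of_def
  using holonomy_relators_closed[of "{1..n+1}" t] t
  by (auto simp: \<tau> cartan_add_mem cartan_scale_mem intro!: bracket_closed trig_delta_closed)

lemma lie_hom_trig_relators:
  assumes F: "F \<in> lie_hom L M" and L: "lie_algebra L" and M: "lie_algebra M"
    and t: "\<And>i j. \<lbrakk>i \<in> {1..n+1}; j \<in> {1..n+1}; i \<noteq> j\<rbrakk> \<Longrightarrow> t i j \<in> carrier L"
    and \<tau>: "\<And>h. h \<in> cartan n \<Longrightarrow> \<tau> h \<in> carrier L"
    and t': "\<And>i j. \<lbrakk>i \<in> {1..n+1}; j \<in> {1..n+1}; i \<noteq> j\<rbrakk> \<Longrightarrow> F (t i j) = t' i j"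
    and \<tau>': "\<And>h. h \<in> cartan n \<Longrightarrow> F (\<tau> h) = \<tau>' h"
    and r: "r \<in> trig_relators_of L n t \<tau>"
  shows "F r \<in> trig_relators_of M n t' \<tau>'"
proof -
  interpret L: lie_algebra L by fact
  interpret M: lie_algebra M by fact
  note hom = lie_homD[OF F]
  interpret T: pair_family L "{1..n+1}" t
    by (intro pair_family.intro pair_family_axioms.intro L) (auto simp: t)
  interpret T': pair_family M "{1..n+1}" t'
    by (intro pair_family.intro pair_family_axioms.intro M) (auto simp: t'[symmetric] t hom)
  have \<delta>: "F (trig_delta L n t \<tau> h) = trig_delta M n t' \<tau>' h" if h: "h \<in> cartan n" for h
  proof -
    let ?c = "\<lambda>i j. h (root_vec i j)"
    have "F (pair_comb L {1..n+1} t ?c) = pair_comb M {1..n+1} (\<lambda>i j. F (t i j)) ?c"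
      by (rule lie_hom_pair_comb[OF T.pair_family_axioms M F])
    also have "\<dots> = pair_comb M {1..n+1} t' ?c"
      unfolding pair_comb_def
      by (rule M.M.finsum_cong'[OF HOL.refl T'.summand_closed]) (auto simp: index_pairs_def t')
    finally show ?thesis
      using \<tau>[OF h] T.pair_comb_closed \<tau>'[OF h]
      unfolding trig_delta_def pair_comb_def[symmetric]
      by (simp add: lie_hom_minus[OF L M F] hom)
  qed
  have "F ` holonomy_relators L {1..n+1} t = holonomy_relators M {1..n+1} t'"
    by (rule lie_hom_holonomy_relators[OF F L t t'])
  then have hol: "F r \<in> holonomy_relators M {1..n+1} t'" if "r \<in> holonomy_relators L {1..n+1} t"
    using that by blast
  have add: "F (\<tau> (cartan_add n h h') \<ominus>\<^bsub>L\<^esub> (\<tau> h \<oplus>\<^bsub>L\<^esub> \<tau> h')) =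
      \<tau>' (cartan_add n h h') \<ominus>\<^bsub>M\<^esub> (\<tau>' h \<oplus>\<^bsub>M\<^esub> \<tau>' h')"
    if "h \<in> cartan n" "h' \<in> cartan n" for h h'
    using that by (simp add: lie_hom_minus[OF L M F] hom \<tau> \<tau>' cartan_add_mem)
  have scale: "F (\<tau> (cartan_scale n c h) \<ominus>\<^bsub>L\<^esub> c \<odot>\<^bsub>L\<^esub> \<tau> h) =
      \<tau>' (cartan_scale n c h) \<ominus>\<^bsub>M\<^esub> c \<odot>\<^bsub>M\<^esub> \<tau>' h"
    if "h \<in> cartan n" for c h
    using that by (simp add: lie_hom_minus[OF L M F] hom \<tau> \<tau>' cartan_scale_mem)
  have comm: "F (bracket L (\<tau> h) (\<tau> h')) = bracket M (\<tau>' h) (\<tau>' h')"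
    if "h \<in> cartan n" "h' \<in> cartan n" for h h'
    using that by (simp add: hom \<tau> \<tau>')
  have \<delta>_closed: "trig_delta L n t \<tau> h \<in> carrier L" if "h \<in> cartan n" for h
    by (rule L.trig_delta_closed) (fact t \<tau>[OF that])+
  have delta: "F (bracket L (t i j) (trig_delta L n t \<tau> h)) = bracket M (t' i j) (trig_delta M n t' \<tau>' h)"
    if "i \<in> {1..n+1}" "j \<in> {1..n+1}" "i \<noteq> j" "h \<in> cartan n" for i j h
    unfolding hom(4)[OF t[OF that(1-3)] \<delta>_closed[OF that(4)]] t'[OF that(1-3)] \<delta>[OF that(4)] ..
  from r consider "r \<in> holonomy_relators L {1..n+1} t"
    | h h' where "h \<in> cartan n" "h' \<in> cartan n"
        "r = \<tau> (cartan_add n h h') \<ominus>\<^bsub>L\<^esub> (\<tau> h \<oplus>\<^bsub>L\<^esub> \<tau> h')"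
    | c h where "h \<in> cartan n" "r = \<tau> (cartan_scale n c h) \<ominus>\<^bsub>L\<^esub> c \<odot>\<^bsub>L\<^esub> \<tau> h"
    | h h' where "h \<in> cartan n" "h' \<in> cartan n" "r = bracket L (\<tau> h) (\<tau> h')"
    | i j h where "i \<in> {1..n+1}" "j \<in> {1..n+1}" "i \<noteq> j" "h \<in> cartan n" "h (root_vec i j) = 0"
        "r = bracket L (t i j) (trig_delta L n t \<tau> h)"
    unfolding trig_relators_of_def by blast
  then show ?thesis
  proof cases
    case 1
    then show ?thesis using hol unfolding trig_relators_of_def by blast
  next
    case 2
    then show ?thesis unfolding 2(3) add[OF 2(1,2)] trig_relators_of_def by blast
  next
    case 3
    then show ?thesis unfolding 3(2) scale[OF 3(1)] trig_relators_of_def by blast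
  next
    case 4
    then show ?thesis unfolding 4(3) comm[OF 4(1,2)] trig_relators_of_def by blast
  next
    case 5
    then show ?thesis unfolding 5(6) delta[OF 5(1-4)] trig_relators_of_def by blast
  qed
qed

lemma trig_gen_mem:
  "\<lbrakk>i \<in> {1..n+1}; j \<in> {1..n+1}; i \<noteq> j\<rbrakk> \<Longrightarrow> TGen {i, j} \<in> trig_gens n"
  "h \<in> cartan n \<Longrightarrow> TauGen h \<in> trig_gens n"
  by (auto simp: trig_gens_def unordered_pairs_def)

lemma trig_relators_closed: "trig_relators n \<subseteq> flie_carrier (trig_gens n)"
proof -
  interpret lie_algebra "free_lie (trig_gens n)" by (rule lie_algebra_free_lie)
  show ?thesis unfolding trig_relators_def free_lie_simps(1)[symmetric]
    by (rule trig_relators_of_closed) (simp_all add: trig_gen_mem flie_carrier.gen)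
qed

lemma lie_algebra_trig_holonomy: "lie_algebra (trig_holonomy n)"
  unfolding trig_holonomy_def by (rule lie_algebra_lie_presented[OF trig_relators_closed])

lemma trig_tau_closed: "h \<in> cartan n \<Longrightarrow> trig_tau n h \<in> carrier (trig_holonomy n)"
  unfolding trig_tau_def trig_holonomy_def
  by (rule lie_presented_gen_carrier[OF trig_relators_closed trig_gen_mem(2)])

lemma pair_family_trig: "pair_family (trig_holonomy n) {1..n+1} (trig_t n)"
  by (intro pair_family.intro pair_family_axioms.intro lie_algebra_trig_holonomy)
     (auto simp: trig_t_def trig_holonomy_def trig_gen_mem
       intro!: lie_presented_gen_carrier[OF trig_relators_closed])

text \<open>Linearity of \<open>\<tau>\<close> is imposed by relators, so it holds only after passage to the quotient of the
  free Lie algebra.\<close>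

lemma trig_tau_linear:
  assumes "h \<in> cartan n"
  shows "h' \<in> cartan n \<Longrightarrow>
      trig_tau n (cartan_add n h h') = trig_tau n h \<oplus>\<^bsub>trig_holonomy n\<^esub> trig_tau n h'"
    and "trig_tau n (cartan_scale n c h) = c \<odot>\<^bsub>trig_holonomy n\<^esub> trig_tau n h"
proof -
  define X where "X = trig_gens n"
  define \<pi> where "\<pi> = (\<lambda>a. lie_ideal_gen (free_lie X) (trig_relators n) +>\<^bsub>free_lie X\<^esub> a)"
  define \<tau> where "\<tau> h = flie_gen (TauGen h)" for h
  interpret L: lie_algebra "free_lie X" by (rule lie_algebra_free_lie)
  interpret T: lie_algebra "trig_holonomy n" by (rule lie_algebra_trig_holonomy)
  have \<pi>: "\<pi> \<in> lie_hom (free_lie X) (trig_holonomy n)"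
    and zero: "\<And>r. r \<in> trig_relators n \<Longrightarrow> \<pi> r = \<zero>\<^bsub>trig_holonomy n\<^esub>"
    unfolding \<pi>_def X_def trig_holonomy_def
    by (rule lie_hom_lie_presented[OF trig_relators_closed], assumption?)+
  note hom = lie_homD[OF \<pi>]
  have \<tau>: "\<tau> g \<in> carrier (free_lie X)" "\<pi> (\<tau> g) = trig_tau n g" if "g \<in> cartan n" for g
    using that by (simp_all add: \<tau>_def X_def \<pi>_def trig_gen_mem flie_carrier.gen trig_tau_def
        lie_presented_gen_def)
  have diff: "\<pi> x = \<pi> y"
    if "x \<in> carrier (free_lie X)" "y \<in> carrier (free_lie X)" "x \<ominus>\<^bsub>free_lie X\<^esub> y \<in> trig_relators n" for x y
    using zero[OF that(3)] that hom
      lie_hom_minus[OF L.lie_algebra_axioms T.lie_algebra_axioms \<pi> that(1,2)] T.minus_eq_zero by simp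
  show "trig_tau n (cartan_add n h h') = trig_tau n h \<oplus>\<^bsub>trig_holonomy n\<^esub> trig_tau n h'"
    if h': "h' \<in> cartan n"
  proof -
    have "\<tau> (cartan_add n h h') \<ominus>\<^bsub>free_lie X\<^esub> (\<tau> h \<oplus>\<^bsub>free_lie X\<^esub> \<tau> h') \<in> trig_relators n"
      using assms h' unfolding trig_relators_def trig_relators_of_def X_def[symmetric] \<tau>_def by blast
    then have "\<pi> (\<tau> (cartan_add n h h')) = \<pi> (\<tau> h \<oplus>\<^bsub>free_lie X\<^esub> \<tau> h')"
      by (intro diff L.M.a_closed \<tau> cartan_add_mem assms h')
    then show ?thesis
      using assms h' \<tau> hom(2)[of "\<tau> h" "\<tau> h'"] by (simp add: cartan_add_mem del: free_lie_simps)
  qed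
  have "\<tau> (cartan_scale n c h) \<ominus>\<^bsub>free_lie X\<^esub> c \<odot>\<^bsub>free_lie X\<^esub> \<tau> h \<in> trig_relators n"
    using assms unfolding trig_relators_def trig_relators_of_def X_def[symmetric] \<tau>_def by blast
  then have "\<pi> (\<tau> (cartan_scale n c h)) = \<pi> (c \<odot>\<^bsub>free_lie X\<^esub> \<tau> h)"
    by (intro diff L.smult_mem \<tau> cartan_scale_mem assms)
  then show "trig_tau n (cartan_scale n c h) = c \<odot>\<^bsub>trig_holonomy n\<^esub> trig_tau n h"
    using assms \<tau> hom(3)[of "\<tau> h" c] by (simp add: cartan_scale_mem del: free_lie_simps)
qed

definition trig_comb ::
    "nat \<Rightarrow> (nat \<Rightarrow> nat \<Rightarrow> complex) \<Rightarrow> ((nat \<Rightarrow> int) \<Rightarrow> complex) \<Rightarrow> trig_gen flie set"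
  where "trig_comb n c h =
    pair_comb (trig_holonomy n) {1..n+1} (trig_t n) c \<oplus>\<^bsub>trig_holonomy n\<^esub> trig_tau n h"

lemma trig_comb_closed: "h \<in> cartan n \<Longrightarrow> trig_comb n c h \<in> carrier (trig_holonomy n)"
proof -
  interpret T: pair_family "trig_holonomy n" "{1..n+1}" "trig_t n" by (rule pair_family_trig)
  show "h \<in> cartan n \<Longrightarrow> trig_comb n c h \<in> carrier (trig_holonomy n)"
    by (simp add: trig_comb_def T.pair_comb_closed[simplified] trig_tau_closed)
qed

lemma trig_comb_add:
  assumes "h \<in> cartan n" "h' \<in> cartan n"
  shows "trig_comb n c h \<oplus>\<^bsub>trig_holonomy n\<^esub> trig_comb n d h' =
    trig_comb n (\<lambda>i j. c i j + d i j) (cartan_add n h h')"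
proof -
  interpret T: pair_family "trig_holonomy n" "{1..n+1}" "trig_t n" by (rule pair_family_trig)
  show ?thesis using assms
    by (simp add: trig_comb_def T.pair_comb_closed[simplified] trig_tau_closed trig_tau_linear
        T.pair_comb_add[symmetric, simplified] T.M.a_ac)
qed

lemma trig_comb_smult:
  assumes "h \<in> cartan n"
  shows "a \<odot>\<^bsub>trig_holonomy n\<^esub> trig_comb n c h = trig_comb n (\<lambda>i j. a * c i j) (cartan_scale n a h)"
proof -
  interpret T: pair_family "trig_holonomy n" "{1..n+1}" "trig_t n" by (rule pair_family_trig)
  show ?thesis using assms
    by (simp add: trig_comb_def T.pair_comb_closed[simplified] trig_tau_closed trig_tau_linear
        T.pair_comb_smult[symmetric, simplified] T.smult_r_distr)
qed

text \<open>Because \<open>\<tau>\<close> is linear, a single \<open>\<tau>(h)\<close> suffices in each element of the generator space.\<close>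

lemma trig_gen_space_subset:
  "trig_gen_space n \<subseteq> {trig_comb n c h |c h. h \<in> cartan n}"
proof -
  interpret T: pair_family "trig_holonomy n" "{1..n+1}" "trig_t n" by (rule pair_family_trig)
  obtain h0 where h0: "h0 \<in> cartan n" using cartan_of_coords[of "\<lambda>_. 0" n] by auto
  have h1: "cartan_scale n 0 h0 \<in> cartan n" using h0 by (rule cartan_scale_mem)
  have \<tau>0: "trig_tau n (cartan_scale n 0 h0) = \<zero>\<^bsub>trig_holonomy n\<^esub>"
    using h0 by (simp add: trig_tau_linear trig_tau_closed)
  have zero: "\<zero>\<^bsub>trig_holonomy n\<^esub> = trig_comb n (\<lambda>i j. 0) (cartan_scale n 0 h0)"
    by (simp add: trig_comb_def \<tau>0 T.pair_comb_zero[simplified])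
  have sub: "submodule {trig_comb n c h |c h. h \<in> cartan n} CC (trig_holonomy n)"
  proof (rule T.submoduleI_smult)
    show "\<zero>\<^bsub>trig_holonomy n\<^esub> \<in> {trig_comb n c h |c h. h \<in> cartan n}"
      using zero h1 by blast
  next
    fix x y assume "x \<in> {trig_comb n c h |c h. h \<in> cartan n}" "y \<in> {trig_comb n c h |c h. h \<in> cartan n}"
    then show "x \<oplus>\<^bsub>trig_holonomy n\<^esub> y \<in> {trig_comb n c h |c h. h \<in> cartan n}"
      using trig_comb_add cartan_add_mem by blast
  next
    fix a x assume "x \<in> {trig_comb n c h |c h. h \<in> cartan n}"
    then show "a \<odot>\<^bsub>trig_holonomy n\<^esub> x \<in> {trig_comb n c h |c h. h \<in> cartan n}"
      using trig_comb_smult cartan_scale_mem by blast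
  qed (use trig_comb_closed in blast)
  have "trig_tau n h = trig_comb n (\<lambda>i j. 0) h" if "h \<in> cartan n" for h
    using that by (simp add: trig_comb_def T.pair_comb_zero[simplified] trig_tau_closed)
  moreover have "trig_t n i j = trig_comb n (\<lambda>a b. of_bool (a = min i j \<and> b = max i j)) (cartan_scale n 0 h0)"
    if "i \<in> {1..n+1}" "j \<in> {1..n+1}" "i \<noteq> j" for i j
  proof -
    have "trig_t n i j = trig_t n (min i j) (max i j)"
      by (auto simp: trig_t_def min_def max_def insert_commute)
    then show ?thesis
      using that T.pair_comb_single[of "min i j" "max i j"] T.t_closed
      by (auto simp: trig_comb_def \<tau>0 min_def max_def)
  qed
  ultimately have "{trig_t n i j |i j. i \<in> {1..n+1} \<and> j \<in> {1..n+1} \<and> i \<noteq> j} \<union> trig_tau n ` cartan n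
      \<subseteq> {trig_comb n c h |c h. h \<in> cartan n}"
    using h1 by blast
  then show ?thesis using sub unfolding trig_gen_space_def lin_span_def by blast
qed


section \<open>The homomorphism\<close>

lemma pair_family_rat: "pair_family (rat_holonomy N) {0..N} (rat_t N)"
  using holonomy_family_rat by (rule holonomy_family.axioms(1))

text \<open>The image of \<open>\<tau>(h)\<close>: the combination \<open>- \<Sum>\<^sub>j h\<^sub>j J\<^sub>j\<close> of Jucys--Murphy elements.\<close>

definition rat_tau :: "nat \<Rightarrow> ((nat \<Rightarrow> int) \<Rightarrow> complex) \<Rightarrow> nat set flie set"
  where "rat_tau n h = rat_comb (n + 1) (\<lambda>i j. - coord h (max i j))"

lemma rat_comb_closed: "rat_comb N c \<in> carrier (rat_holonomy N)"
  unfolding rat_comb_def by (rule pair_family.pair_comb_closed[OF pair_family_rat])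

lemma rat_comb_cong:
  "(\<And>i j. \<lbrakk>i < j; j \<le> N\<rbrakk> \<Longrightarrow> c i j = d i j) \<Longrightarrow> rat_comb N c = rat_comb N d"
  unfolding rat_comb_def by (rule pair_family.pair_comb_cong[OF pair_family_rat]) auto

lemma rat_comb_zero: "rat_comb N (\<lambda>i j. 0) = \<zero>\<^bsub>rat_holonomy N\<^esub>"
  unfolding rat_comb_def by (rule pair_family.pair_comb_zero[OF pair_family_rat])

lemma rat_comb_add:
  "rat_comb N c \<oplus>\<^bsub>rat_holonomy N\<^esub> rat_comb N d = rat_comb N (\<lambda>i j. c i j + d i j)"
  unfolding rat_comb_def by (rule pair_family.pair_comb_add[OF pair_family_rat])

lemma rat_comb_smult: "a \<odot>\<^bsub>rat_holonomy N\<^esub> rat_comb N c = rat_comb N (\<lambda>i j. a * c i j)"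
  unfolding rat_comb_def by (rule pair_family.pair_comb_smult[OF pair_family_rat])

lemma rat_comb_minus:
  "rat_comb N c \<ominus>\<^bsub>rat_holonomy N\<^esub> rat_comb N d = rat_comb N (\<lambda>i j. c i j - d i j)"
  unfolding rat_comb_def by (rule pair_family.pair_comb_minus[OF pair_family_rat])

lemma rat_comb_positive_indices:
  "pair_comb (rat_holonomy (n + 1)) {1..n+1} (rat_t (n + 1)) c =
    rat_comb (n + 1) (\<lambda>i j. if i = 0 then 0 else c i j)"
proof -
  have "pair_comb (rat_holonomy (n + 1)) {1..n+1} (rat_t (n + 1)) c = rat_comb (n + 1)
      (\<lambda>i j. if i \<in> {1..n+1} \<and> j \<in> {1..n+1} then c i j else 0)"
    unfolding rat_comb_def by (rule pair_family.pair_comb_subset[OF pair_family_rat]) auto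
  also have "\<dots> = rat_comb (n + 1) (\<lambda>i j. if i = 0 then 0 else c i j)"
    by (rule rat_comb_cong) auto
  finally show ?thesis .
qed

text \<open>The correction term in \<open>\<delta>(h)\<close> symmetrises the coefficient \<open>- h\<^sub>j\<close> at \<open>1 \<le> i < j\<close> to
  \<open>- (h\<^sub>i + h\<^sub>j) / 2\<close>.  When \<open>h\<^sub>a = h\<^sub>b\<close>, these coefficients do not distinguish \<open>a\<close>
  from \<open>b\<close>.\<close>

lemma rat_t_delta_commute:
  assumes ab: "a \<in> {1..n+1}" "b \<in> {1..n+1}" "a \<noteq> b" and h: "h \<in> cartan n" "h (root_vec a b) = 0"
  shows "bracket (rat_holonomy (n + 1)) (rat_t (n + 1) a b)
    (trig_delta (rat_holonomy (n + 1)) n (rat_t (n + 1)) (rat_tau n) h) = \<zero>\<^bsub>rat_holonomy (n + 1)\<^esub>"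
proof -
  interpret R: holonomy_family "rat_holonomy (n + 1)" "{0..n+1}" "rat_t (n + 1)"
    by (rule holonomy_family_rat)
  define c where "c i j = (if i = 0 then - coord h j else if j = 0 then - coord h i
    else - (coord h i + coord h j) / 2)" for i j
  have "trig_delta (rat_holonomy (n + 1)) n (rat_t (n + 1)) (rat_tau n) h =
      rat_comb (n + 1) (\<lambda>i j. - coord h (max i j) - 1 / 2 * (if i = 0 then 0 else h (root_vec i j)))"
    unfolding trig_delta_def pair_comb_def[symmetric] rat_comb_positive_indices rat_tau_def
    by (simp only: rat_comb_smult rat_comb_minus)
  also have "\<dots> = rat_comb (n + 1) c"
    by (rule rat_comb_cong) (simp add: c_def cartan_root[OF h(1)] max_def field_simps)
  finally show ?thesis
    using R.bracket_t_pair_comb[of a b c] ab h cartan_root[OF h(1) ab(1,2)]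
    by (auto simp: rat_comb_def c_def add.commute)
qed

lemma rat_trig_relators:
  "trig_relators_of (rat_holonomy (n + 1)) n (rat_t (n + 1)) (rat_tau n)
    \<subseteq> {\<zero>\<^bsub>rat_holonomy (n + 1)\<^esub>}"
proof -
  interpret R: holonomy_family "rat_holonomy (n + 1)" "{0..n+1}" "rat_t (n + 1)"
    by (rule holonomy_family_rat)
  have "holonomy_relators (rat_holonomy (n + 1)) {1..n+1} (rat_t (n + 1))
      \<subseteq> holonomy_relators (rat_holonomy (n + 1)) {0..n+1} (rat_t (n + 1))"
    unfolding holonomy_relators_def by (intro Un_mono Collect_mono) (auto 0 4)
  then have "holonomy_relators (rat_holonomy (n + 1)) {1..n+1} (rat_t (n + 1))
      \<subseteq> {\<zero>\<^bsub>rat_holonomy (n + 1)\<^esub>}"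
    using R.relators_zero by blast
  moreover have "rat_tau n (cartan_add n h h') \<ominus>\<^bsub>rat_holonomy (n + 1)\<^esub>
      (rat_tau n h \<oplus>\<^bsub>rat_holonomy (n + 1)\<^esub> rat_tau n h') = \<zero>\<^bsub>rat_holonomy (n + 1)\<^esub>" for h h'
    unfolding rat_tau_def rat_comb_add rat_comb_minus rat_comb_zero[symmetric]
    by (rule rat_comb_cong) (simp add: coord_cartan_add max_def)
  moreover have "rat_tau n (cartan_scale n c h) \<ominus>\<^bsub>rat_holonomy (n + 1)\<^esub>
      c \<odot>\<^bsub>rat_holonomy (n + 1)\<^esub> rat_tau n h = \<zero>\<^bsub>rat_holonomy (n + 1)\<^esub>" for c h
    unfolding rat_tau_def rat_comb_smult rat_comb_minus rat_comb_zero[symmetric]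
    by (rule rat_comb_cong) (simp add: coord_cartan_scale max_def)
  moreover have "bracket (rat_holonomy (n + 1)) (rat_tau n h) (rat_tau n h') =
      \<zero>\<^bsub>rat_holonomy (n + 1)\<^esub>" for h h'
    unfolding rat_tau_def rat_comb_def by (rule R.pair_comb_max_commute)
  ultimately show ?thesis
    unfolding trig_relators_of_def by (auto simp: rat_t_delta_commute[simplified])
qed

lemma trig_to_rat_exists:
  "\<exists>\<psi>\<in>lie_hom (trig_holonomy n) (rat_holonomy (n + 1)).
    (\<forall>i\<in>{1..n+1}. \<forall>j\<in>{1..n+1}. i \<noteq> j \<longrightarrow> \<psi> (trig_t n i j) = rat_t (n + 1) i j) \<and>
    (\<forall>h\<in>cartan n. \<psi> (trig_tau n h) = rat_tau n h)"
proof -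
  define f where "f x = (case x of TGen e \<Rightarrow> lie_presented_gen (rat_gens (n + 1)) (rat_relators (n + 1)) e
    | TauGen h \<Rightarrow> rat_tau n h)" for x
  have f_t: "f (TGen {i, j}) = rat_t (n + 1) i j" for i j by (simp add: f_def rat_t_def)
  have f_\<tau>: "f (TauGen h) = rat_tau n h" for h by (simp add: f_def)
  have f: "f \<in> trig_gens n \<rightarrow> carrier (rat_holonomy (n + 1))"
    by (auto simp: trig_gens_def unordered_pairs_def f_t f_\<tau> rat_t_closed rat_tau_def
      intro: rat_comb_closed[of "n + 1", simplified])
  have "\<exists>\<psi>\<in>lie_hom (trig_holonomy n) (rat_holonomy (n + 1)).
      \<forall>x\<in>trig_gens n. \<psi> (lie_presented_gen (trig_gens n) (trig_relators n) x) = f x"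
    unfolding trig_holonomy_def
  proof (rule lie_presented_universal[OF trig_relators_closed lie_algebra_rat_holonomy f])
    fix F r
    assume F: "F \<in> lie_hom (free_lie (trig_gens n)) (rat_holonomy (n + 1))"
      and eq: "\<And>x. x \<in> trig_gens n \<Longrightarrow> F (flie_gen x) = f x" and r: "r \<in> trig_relators n"
    have "F r \<in> trig_relators_of (rat_holonomy (n + 1)) n (rat_t (n + 1)) (rat_tau n)"
      by (rule lie_hom_trig_relators[OF F lie_algebra_free_lie lie_algebra_rat_holonomy _ _ _ _
            r[unfolded trig_relators_def]])
         (simp_all add: eq trig_gen_mem f_t f_\<tau> flie_carrier.gen)
    then show "F r = \<zero>\<^bsub>rat_holonomy (n + 1)\<^esub>" using rat_trig_relators by blast
  qed
  then obtain \<psi> where "\<psi> \<in> lie_hom (trig_holonomy n) (rat_holonomy (n + 1))"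
    "\<And>x. x \<in> trig_gens n \<Longrightarrow> \<psi> (lie_presented_gen (trig_gens n) (trig_relators n) x) = f x"
    by blast
  then show ?thesis
    by (intro bexI[of _ \<psi>] conjI ballI impI)
       (simp_all only: trig_t_def trig_tau_def trig_gen_mem f_t f_\<tau> simp_thms)
qed

locale trig_to_rat =
  fixes n :: nat and \<psi> :: "trig_gen flie set \<Rightarrow> nat set flie set"
  assumes hom: "\<psi> \<in> lie_hom (trig_holonomy n) (rat_holonomy (n + 1))"
    and \<psi>_t: "\<lbrakk>i \<in> {1..n+1}; j \<in> {1..n+1}; i \<noteq> j\<rbrakk> \<Longrightarrow> \<psi> (trig_t n i j) = rat_t (n + 1) i j"
    and \<psi>_tau: "h \<in> cartan n \<Longrightarrow> \<psi> (trig_tau n h) = rat_tau n h"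
begin

lemma \<psi>_trig_comb:
  assumes h: "h \<in> cartan n"
  shows "\<psi> (trig_comb n c h) =
    rat_comb (n + 1) (\<lambda>i j. (if i = 0 then 0 else c i j) - coord h (max i j))"
proof -
  interpret T: pair_family "trig_holonomy n" "{1..n+1}" "trig_t n" by (rule pair_family_trig)
  interpret R: lie_algebra "rat_holonomy (n + 1)" by (rule lie_algebra_rat_holonomy)
  have "\<psi> (pair_comb (trig_holonomy n) {1..n+1} (trig_t n) c) =
      pair_comb (rat_holonomy (n + 1)) {1..n+1} (\<lambda>i j. \<psi> (trig_t n i j)) c"
    by (rule lie_hom_pair_comb[OF pair_family_trig lie_algebra_rat_holonomy hom])
  also have "\<dots> = pair_comb (rat_holonomy (n + 1)) {1..n+1} (rat_t (n + 1)) c"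
    unfolding pair_comb_def
    by (rule R.M.finsum_cong'[OF HOL.refl])
       (auto simp: index_pairs_def \<psi>_t[simplified] rat_t_closed[of _ "Suc n", simplified]
         R.smult_mem[simplified])
  also have "\<dots> = rat_comb (n + 1) (\<lambda>i j. if i = 0 then 0 else c i j)"
    by (rule rat_comb_positive_indices)
  finally have "\<psi> (trig_comb n c h) = rat_comb (n + 1) (\<lambda>i j. if i = 0 then 0 else c i j)
      \<oplus>\<^bsub>rat_holonomy (n + 1)\<^esub> rat_tau n h"
    unfolding trig_comb_def
    by (simp only: lie_homD(2)[OF hom T.pair_comb_closed trig_tau_closed[OF h]] \<psi>_tau[OF h])
  then show ?thesis by (simp only: rat_tau_def rat_comb_add) simp
qed

text \<open>The coefficients at \<open>(0, j)\<close> come from \<open>\<tau>(h)\<close> only and equal \<open>- coord h j\<close>, so they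
  determine \<open>h\<close>; the other coefficients then determine \<open>c\<close>.\<close>

lemma inj_on_trig_gen_space: "inj_on \<psi> (trig_gen_space n)"
proof (rule inj_onI)
  fix x y assume "x \<in> trig_gen_space n" "y \<in> trig_gen_space n" and eq: "\<psi> x = \<psi> y"
  then obtain c h d h' where x: "x = trig_comb n c h" "h \<in> cartan n"
    and y: "y = trig_comb n d h'" "h' \<in> cartan n"
    using subsetD[OF trig_gen_space_subset, of x] subsetD[OF trig_gen_space_subset, of y] by blast
  have eq': "(if i = 0 then 0 else c i j) - coord h (max i j) =
      (if i = 0 then 0 else d i j) - coord h' (max i j)"
    if "i \<in> {0..n+1}" "j \<in> {0..n+1}" "i < j" for i j
    using rat_comb_coefficient[OF that eq[unfolded x(1) y(1) \<psi>_trig_comb[OF x(2)] \<psi>_trig_comb[OF y(2)]]] .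
  have "h = h'"
    using x(2) y(2) by (rule cartan_eqI) (use eq'[of 0] in auto)
  moreover from this have "c i j = d i j" if "i \<in> {1..n+1}" "j \<in> {1..n+1}" "i < j" for i j
    using eq'[of i j] that by auto
  ultimately show "x = y"
    unfolding x(1) y(1) trig_comb_def
    using pair_family.pair_comb_cong[OF pair_family_trig, of n c d] by simp
qed

text \<open>Subtracting a multiple of the central element removes the coefficient at \<open>(0, 1)\<close>, which every
  element \<open>- \<Sum>\<^sub>j h\<^sub>j J\<^sub>j\<close> with \<open>h\<^sub>1 = 0\<close> lacks.  The coefficients at \<open>(0, j)\<close> then
  dictate \<open>h\<close>, and those at \<open>1 \<le> i < j\<close> are adjusted by the \<open>t i j\<close>.\<close>

lemma rat_comb_in_image_modulo_central:
  "\<exists>x\<in>carrier (trig_holonomy n). \<psi> x = rat_comb (n + 1) (\<lambda>i j. d i j - d 0 1)"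
proof -
  obtain h where h: "h \<in> cartan n" "\<And>j. j \<in> {1..n+1} \<Longrightarrow> coord h j = d 0 1 - d 0 j"
    using cartan_of_coords[of "\<lambda>j. d 0 1 - d 0 j" n] by auto
  have "\<psi> (trig_comb n (\<lambda>i j. d i j - d 0 j) h) = rat_comb (n + 1) (\<lambda>i j. d i j - d 0 1)"
    unfolding \<psi>_trig_comb[OF h(1)] by (rule rat_comb_cong) (auto simp: h(2) max_def)
  then show ?thesis using trig_comb_closed[OF h(1)] by blast
qed

end

lemma rat_central_eq: "rat_central N = rat_comb N (\<lambda>i j. 1)"
proof -
  interpret R: pair_family "rat_holonomy N" "{0..N}" "rat_t N" by (rule pair_family_rat)
  show ?thesis
    unfolding rat_central_def rat_comb_def pair_comb_def
    by (rule R.M.finsum_cong'[OF HOL.refl R.summand_closed])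
       (auto simp: index_pairs_def rat_t_closed)
qed

lemma rat_central_ideal:
  "lie_ideal (rat_central_ideal N) (rat_holonomy N)" "rat_central N \<in> rat_central_ideal N"
  unfolding rat_central_ideal_def
  by (rule lie_ideal_lie_ideal_gen[OF lie_algebra_rat_holonomy])
     (auto simp: rat_central_eq rat_comb_closed lie_ideal_gen_def)

lemma (in trig_to_rat) surjective_modulo_central:
  defines "M \<equiv> lie_quot (rat_holonomy (n + 1)) (rat_central_ideal (n + 1))"
    and "\<pi> \<equiv> (\<lambda>x. rat_central_ideal (n + 1) +>\<^bsub>rat_holonomy (n + 1)\<^esub> x)"
  shows "\<pi> \<circ> \<psi> \<in> lie_hom (trig_holonomy n) M"
    and "(\<pi> \<circ> \<psi>) ` carrier (trig_holonomy n) = carrier M"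
proof -
  note Z = rat_central_ideal[of "n + 1"]
  note R = lie_algebra_rat_holonomy[of "n + 1"]
  interpret R: pair_family "rat_holonomy (n + 1)" "{0..n+1}" "rat_t (n + 1)"
    by (rule pair_family_rat)
  interpret T: lie_algebra "trig_holonomy n" by (rule lie_algebra_trig_holonomy)
  have \<pi>: "\<pi> \<in> lie_hom (rat_holonomy (n + 1)) M"
    unfolding \<pi>_def M_def by (rule lie_hom_lie_quot[OF R Z(1)])
  show hom': "\<pi> \<circ> \<psi> \<in> lie_hom (trig_holonomy n) M"
    by (rule lie_hom_comp[OF hom \<pi>])
  define S where "S = (\<pi> \<circ> \<psi>) ` carrier (trig_holonomy n)"
  note hom'' = lie_homD[OF hom'] and \<pi>_hom = lie_homD[OF \<pi>, unfolded rat_holonomy_def]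
  have S_add: "a \<oplus>\<^bsub>M\<^esub> b \<in> S" and S_bracket: "bracket M a b \<in> S" if a: "a \<in> S" and b: "b \<in> S" for a b
  proof -
    obtain x where x: "x \<in> carrier (trig_holonomy n)" "a = (\<pi> \<circ> \<psi>) x"
      using a unfolding S_def by (rule imageE)
    obtain y where y: "y \<in> carrier (trig_holonomy n)" "b = (\<pi> \<circ> \<psi>) y"
      using b unfolding S_def by (rule imageE)
    show "a \<oplus>\<^bsub>M\<^esub> b \<in> S" "bracket M a b \<in> S"
      unfolding S_def x(2) y(2) hom''(2,4)[OF x(1) y(1), symmetric]
      by (intro imageI T.M.a_closed T.bracket_closed x(1) y(1))+
  qed
  have S_smult: "c \<odot>\<^bsub>M\<^esub> a \<in> S" if a: "a \<in> S" for a c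
  proof -
    obtain x where x: "x \<in> carrier (trig_holonomy n)" "a = (\<pi> \<circ> \<psi>) x"
      using a unfolding S_def by (rule imageE)
    show ?thesis
      unfolding S_def x(2) hom''(3)[OF x(1), symmetric] by (intro imageI T.smult_mem x(1))
  qed
  have comb: "\<pi> (rat_comb (n + 1) d) \<in> S" for d
  proof -
    obtain x where x: "x \<in> carrier (trig_holonomy n)" "\<psi> x = rat_comb (n + 1) (\<lambda>i j. d i j - d 0 1)"
      using rat_comb_in_image_modulo_central by blast
    have "d 0 1 \<odot>\<^bsub>rat_holonomy (n + 1)\<^esub> rat_central (n + 1) \<in> rat_central_ideal (n + 1)"
      using Z R.submodule_mem(4) unfolding lie_ideal_def by blast
    moreover have "rat_comb (n + 1) d \<ominus>\<^bsub>rat_holonomy (n + 1)\<^esub> \<psi> x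
        = d 0 1 \<odot>\<^bsub>rat_holonomy (n + 1)\<^esub> rat_central (n + 1)"
      unfolding x(2) rat_comb_minus rat_central_eq rat_comb_smult by (rule rat_comb_cong) simp
    ultimately have "\<pi> (rat_comb (n + 1) d) = \<pi> (\<psi> x)"
      unfolding \<pi>_def lie_coset_eq_iff[OF R Z(1) rat_comb_closed lie_homD(1)[OF hom x(1)]] by (simp only:)
    then show ?thesis using x(1) unfolding S_def by (metis comp_apply imageI)
  qed
  have "\<pi> y \<in> S" if "y \<in> carrier (rat_holonomy (n + 1))" for y
    using rat_relators_closed that unfolding rat_holonomy_def
  proof (induction y rule: lie_presented_induct)
    case (gen e)
    then obtain a b where ab: "e = {a, b}" "a \<in> {0..n+1}" "b \<in> {0..n+1}" "a \<noteq> b"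
      unfolding rat_gens_def unordered_pairs_def by blast
    define i j where "i = min a b" and "j = max a b"
    have e: "e = {i, j}" "i \<in> {0..n+1}" "j \<in> {0..n+1}" "i < j"
      using ab by (auto simp: i_def j_def min_def max_def)
    have "lie_presented_gen (rat_gens (n + 1)) (rat_relators (n + 1)) e =
        rat_comb (n + 1) (\<lambda>a b. of_bool (a = i \<and> b = j))"
      unfolding rat_comb_def R.pair_comb_single[OF e(2-4)] by (simp add: rat_t_def e(1))
    then show ?case by (simp only: comb)
  next
    case zero
    show ?case
      using comb[of "\<lambda>i j. 0"] unfolding rat_comb_zero by (simp only: rat_holonomy_def)
  next
    case (add x y)
    then show ?case by (simp only: \<pi>_hom S_add)
  next
    case (smult c x)
    then show ?case by (simp only: \<pi>_hom S_smult)
  next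
    case (bracket x y)
    then show ?case by (simp only: \<pi>_hom S_bracket)
  qed
  moreover have "carrier M = \<pi> ` carrier (rat_holonomy (n + 1))"
    unfolding M_def \<pi>_def by (rule carrier_lie_quot[OF R Z(1)])
  ultimately show "(\<pi> \<circ> \<psi>) ` carrier (trig_holonomy n) = carrier M"
    using hom''(1) by (auto simp: S_def)
qed


section \<open>Bethe and Gaudin subspaces\<close>

lemma rat_central_line:
  "lin_span (rat_holonomy N) {rat_central N} = range (\<lambda>a. rat_comb N (\<lambda>i j. a))"
  using lie_algebra.lin_span_singleton[OF lie_algebra_rat_holonomy rat_comb_closed, of N "\<lambda>i j. 1"]
  by (simp add: rat_central_eq rat_comb_smult)

lemma gaudin_H_eq: "gaudin_H N g \<chi> = rat_comb N (\<lambda>i j. (g i - g j) / (\<chi> i - \<chi> j))"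
  by (simp add: gaudin_H_def rat_comb_def pair_comb_def)

lemma gaudin_subspace_eq: "gaudin_subspace N \<chi> = range (\<lambda>g. gaudin_H N g \<chi>)"
proof -
  interpret R: lie_algebra "rat_holonomy N" by (rule lie_algebra_rat_holonomy)
  have add: "gaudin_H N g \<chi> \<oplus>\<^bsub>rat_holonomy N\<^esub> gaudin_H N g' \<chi> = gaudin_H N (\<lambda>i. g i + g' i) \<chi>" for g g'
    unfolding gaudin_H_eq rat_comb_add by (rule rat_comb_cong) (simp add: add_divide_distrib[symmetric])
  have smult: "a \<odot>\<^bsub>rat_holonomy N\<^esub> gaudin_H N g \<chi> = gaudin_H N (\<lambda>i. a * g i) \<chi>" for a g
    unfolding gaudin_H_eq rat_comb_smult by (rule rat_comb_cong) (simp add: right_diff_distrib)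
  have closed: "gaudin_H N g \<chi> \<in> carrier (rat_holonomy N)" for g
    by (simp add: gaudin_H_eq rat_comb_closed)
  have "\<zero>\<^bsub>rat_holonomy N\<^esub> = gaudin_H N (\<lambda>i. 0) \<chi>"
    by (simp add: gaudin_H_eq rat_comb_zero)
  then have "submodule (range (\<lambda>g. gaudin_H N g \<chi>)) CC (rat_holonomy N)"
    by (intro R.submoduleI_smult) (auto simp: add smult closed)
  then show ?thesis unfolding gaudin_subspace_def by (rule R.lin_span_submodule)
qed

text \<open>The coefficient of \<open>t i j\<close> in \<open>BH(C, h)\<close>, including its sign.\<close>

definition bethe_coeff :: "((nat \<Rightarrow> int) \<Rightarrow> complex) \<Rightarrow> ((nat \<Rightarrow> int) \<Rightarrow> complex) \<Rightarrow> nat \<Rightarrow> nat \<Rightarrow> complex"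
  where "bethe_coeff C h i j = - (C (root_vec i j) * h (root_vec i j) / (C (root_vec i j) - 1))"

lemma bethe_BH_eq:
  assumes h: "h \<in> cartan n"
  shows "bethe_BH n C h = trig_comb n (bethe_coeff C h) h"
proof -
  interpret T: pair_family "trig_holonomy n" "{1..n+1}" "trig_t n" by (rule pair_family_trig)
  let ?P = "pair_comb (trig_holonomy n) {1..n+1} (trig_t n)
    (\<lambda>i j. C (root_vec i j) * h (root_vec i j) / (C (root_vec i j) - 1))"
  have "bethe_BH n C h = trig_tau n h \<ominus>\<^bsub>trig_holonomy n\<^esub> ?P"
    by (simp only: bethe_BH_def pair_comb_def)
  also have "\<dots> = (\<ominus>\<^bsub>trig_holonomy n\<^esub> ?P) \<oplus>\<^bsub>trig_holonomy n\<^esub> trig_tau n h"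
    unfolding a_minus_def
    by (rule T.M.a_comm[OF trig_tau_closed[OF h] T.M.a_inv_closed[OF T.pair_comb_closed]])
  finally show ?thesis
    by (simp only: trig_comb_def T.pair_comb_uminus bethe_coeff_def[abs_def])
qed

lemma bethe_subspace_eq: "bethe_subspace n C = bethe_BH n C ` cartan n"
proof -
  interpret T: pair_family "trig_holonomy n" "{1..n+1}" "trig_t n" by (rule pair_family_trig)
  obtain h0 where h0: "h0 \<in> cartan n" using cartan_of_coords[of "\<lambda>_. 0" n] by auto
  have add: "bethe_BH n C h \<oplus>\<^bsub>trig_holonomy n\<^esub> bethe_BH n C h' = bethe_BH n C (cartan_add n h h')"
    if "h \<in> cartan n" "h' \<in> cartan n" for h h'
  proof -
    have "pair_comb (trig_holonomy n) {1..n+1} (trig_t n) (\<lambda>i j. bethe_coeff C h i j + bethe_coeff C h' i j)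
        = pair_comb (trig_holonomy n) {1..n+1} (trig_t n) (bethe_coeff C (cartan_add n h h'))"
      by (rule T.pair_comb_cong)
         (simp add: bethe_coeff_def cartan_add_def root_vec_mem distrib_left add_divide_distrib)
    then show ?thesis
      using that by (simp add: bethe_BH_eq cartan_add_mem trig_comb_add) (simp add: trig_comb_def)
  qed
  have smult: "a \<odot>\<^bsub>trig_holonomy n\<^esub> bethe_BH n C h = bethe_BH n C (cartan_scale n a h)"
    if "h \<in> cartan n" for a h
  proof -
    have "pair_comb (trig_holonomy n) {1..n+1} (trig_t n) (\<lambda>i j. a * bethe_coeff C h i j)
        = pair_comb (trig_holonomy n) {1..n+1} (trig_t n) (bethe_coeff C (cartan_scale n a h))"
      by (rule T.pair_comb_cong)
         (simp add: bethe_coeff_def cartan_scale_def root_vec_mem)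
    then show ?thesis
      using that by (simp add: bethe_BH_eq cartan_scale_mem trig_comb_smult) (simp add: trig_comb_def)
  qed
  have closed: "bethe_BH n C h \<in> carrier (trig_holonomy n)" if "h \<in> cartan n" for h
    using that by (simp add: bethe_BH_eq trig_comb_closed)
  have "\<zero>\<^bsub>trig_holonomy n\<^esub> = bethe_BH n C (cartan_scale n 0 h0)"
    using smult[OF h0, of 0] closed[OF h0] by simp
  then have "submodule (bethe_BH n C ` cartan n) CC (trig_holonomy n)"
    using h0 by (intro T.submoduleI_smult) (auto simp: add smult closed cartan_add_mem cartan_scale_mem)
  then show ?thesis unfolding bethe_subspace_def by (rule T.lin_span_submodule)
qed

text \<open>Regularity provides some diagonal representative with distinct entries; the ratios of entries do not
  depend on the representative.\<close>

lemma torus_reg_inj_on: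
  assumes nz: "\<And>i. i \<in> {1..n+1} \<Longrightarrow> z i \<noteq> 0" and reg: "torus_diag n z \<in> torus_reg n"
  shows "inj_on z {1..n+1}"
proof (rule inj_onI, rule ccontr)
  fix i j assume ij: "i \<in> {1..n+1}" "j \<in> {1..n+1}" "z i = z j" "i \<noteq> j"
  obtain w where w: "inj_on w {1..n+1}" "torus_diag n z = torus_diag n w"
    using reg by (auto simp: torus_reg_def)
  have "w i / w j = z i / z j" using torus_diag_root[OF ij(1,2,4)] w(2) by metis
  then have "w i = w j" using ij(2,3) nz[OF ij(2)] by (simp add: divide_eq_1_iff)
  then show False using w(1) ij by (auto dest: inj_onD)
qed

locale regular_trig_to_rat = trig_to_rat +
  fixes z :: "nat \<Rightarrow> complex"
  assumes z_nz: "i \<in> {1..n+1} \<Longrightarrow> z i \<noteq> 0" and z_inj: "inj_on z {1..n+1}"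
begin

definition \<chi> :: "nat \<Rightarrow> complex"
  where "\<chi> = (\<lambda>i. if i = 0 then 0 else z i)"

lemma \<chi>_distinct: "\<lbrakk>i < j; j \<le> n + 1\<rbrakk> \<Longrightarrow> \<chi> i - \<chi> j \<noteq> 0"
  using z_nz[of j] inj_onD[OF z_inj, of i j] by (auto simp: \<chi>_def)

text \<open>At \<open>1 \<le> i < j\<close> this is the identity
  \<open>\<chi>\<^sub>i h\<^sub>i - \<chi>\<^sub>j h\<^sub>j = \<chi>\<^sub>i (h\<^sub>i - h\<^sub>j) + (\<chi>\<^sub>i - \<chi>\<^sub>j) h\<^sub>j\<close>;
  at \<open>i = 0\<close> it uses \<open>\<chi>\<^sub>0 = 0\<close>.\<close>

lemma \<psi>_bethe_BH:
  assumes h: "h \<in> cartan n"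
  shows "\<psi> (bethe_BH n (torus_diag n z) h) = gaudin_H (n + 1) (\<lambda>i. - (\<chi> i * coord h i)) \<chi>"
  unfolding bethe_BH_eq[OF h] \<psi>_trig_comb[OF h] gaudin_H_eq
proof (rule rat_comb_cong)
  fix i j assume ij: "i < j" "j \<le> n + 1"
  have zj: "z j \<noteq> 0" using z_nz[of j] ij by auto
  show "(if i = 0 then 0 else bethe_coeff (torus_diag n z) h i j) - coord h (max i j) =
      (- (\<chi> i * coord h i) - - (\<chi> j * coord h j)) / (\<chi> i - \<chi> j)"
  proof (cases "i = 0")
    case True
    then show ?thesis using ij zj by (simp add: \<chi>_def)
  next
    case False
    have ne: "z i - z j \<noteq> 0" using \<chi>_distinct[OF ij] False ij by (simp add: \<chi>_def)
    have i: "i \<in> {1..n+1}" and j: "j \<in> {1..n+1}" "i \<noteq> j" using False ij by auto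
    have "z i / z j - 1 = (z i - z j) / z j" using zj by (simp add: diff_divide_distrib)
    then have "bethe_coeff (torus_diag n z) h i j = - (z i * (coord h i - coord h j) / (z i - z j))"
      unfolding bethe_coeff_def torus_diag_root[OF i j] cartan_root[OF h i j(1)] using zj by simp
    then show ?thesis
      using False ij ne by (simp add: \<chi>_def max_def field_simps)
  qed
qed

lemma \<psi>_bethe_subspace:
  "\<psi> ` bethe_subspace n (torus_diag n z) =
    (\<lambda>h. gaudin_H (n + 1) (\<lambda>i. - (\<chi> i * coord h i)) \<chi>) ` cartan n"
  by (simp add: bethe_subspace_eq image_image \<psi>_bethe_BH)

text \<open>\<open>H(g, \<chi>)\<close> is linear in \<open>g\<close>, vanishes on constants, and is the central element at \<open>g = \<chi>\<close>.
  Every \<open>g\<close> can be shifted by a constant and a multiple of \<open>\<chi>\<close> so that \<open>g\<^sub>0 = g\<^sub>1 = 0\<close>, and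
  then \<open>g\<^sub>i / \<chi>\<^sub>i\<close> are the coordinates of an element of the Cartan subalgebra.\<close>

lemma gaudin_subspace_decomposition:
  "gaudin_subspace (n + 1) \<chi> = \<psi> ` bethe_subspace n (torus_diag n z)
    <+>\<^bsub>rat_holonomy (n + 1)\<^esub> lin_span (rat_holonomy (n + 1)) {rat_central (n + 1)}"
proof -
  have central: "gaudin_H (n + 1) g \<chi> \<oplus>\<^bsub>rat_holonomy (n + 1)\<^esub> rat_comb (n + 1) (\<lambda>i j. a) =
      gaudin_H (n + 1) (\<lambda>i. g i + a * \<chi> i) \<chi>" for g a
    unfolding gaudin_H_eq rat_comb_add
    by (rule rat_comb_cong) (use \<chi>_distinct in \<open>simp add: field_simps\<close>)
  have expand: "\<exists>h\<in>cartan n. \<exists>a. gaudin_H (n + 1) g \<chi> =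
      gaudin_H (n + 1) (\<lambda>i. - (\<chi> i * coord h i) + a * \<chi> i) \<chi>" for g
  proof -
    \<comment> \<open>The multiple of \<open>\<chi>\<close> that makes the first coordinate of \<open>h\<close> vanish.\<close>
    define a where "a = (g 1 - g 0) / \<chi> 1"
    obtain h where h: "h \<in> cartan n" "\<And>j. j \<in> {1..n+1} \<Longrightarrow> coord h j = a - (g j - g 0) / \<chi> j"
      using cartan_of_coords[of "\<lambda>j. a - (g j - g 0) / \<chi> j" n] by (auto simp: a_def)
    have "- (\<chi> i * coord h i) + a * \<chi> i = g i - g 0" if "i \<le> n + 1" for i
    proof (cases "i = 0")
      case False
      then have "\<chi> i \<noteq> 0" using z_nz[of i] that by (simp add: \<chi>_def)
      then show ?thesis using False that h(2)[of i] by (simp add: field_simps)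
    qed (simp add: \<chi>_def)
    then have "gaudin_H (n + 1) g \<chi> = gaudin_H (n + 1) (\<lambda>i. - (\<chi> i * coord h i) + a * \<chi> i) \<chi>"
      unfolding gaudin_H_eq by (intro rat_comb_cong) simp
    then show ?thesis using h(1) by blast
  qed
  have sum: "\<psi> ` bethe_subspace n (torus_diag n z)
      <+>\<^bsub>rat_holonomy (n + 1)\<^esub> range (\<lambda>a. rat_comb (n + 1) (\<lambda>i j. a)) =
      (\<Union>h\<in>cartan n. range (\<lambda>a. gaudin_H (n + 1) (\<lambda>i. - (\<chi> i * coord h i) + a * \<chi> i) \<chi>))"
    unfolding \<psi>_bethe_subspace set_add_def' central[symmetric] by blast
  have mem: "gaudin_H (n + 1) g \<chi> \<in>
      (\<Union>h\<in>cartan n. range (\<lambda>a. gaudin_H (n + 1) (\<lambda>i. - (\<chi> i * coord h i) + a * \<chi> i) \<chi>))" for g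
    using expand[of g] by (elim bexE exE) (simp only:, rule UN_I, assumption, rule rangeI)
  have "range (\<lambda>g. gaudin_H (n + 1) g \<chi>) =
      (\<Union>h\<in>cartan n. range (\<lambda>a. gaudin_H (n + 1) (\<lambda>i. - (\<chi> i * coord h i) + a * \<chi> i) \<chi>))"
    by (intro equalityI image_subsetI UN_least rangeI mem)
  then show ?thesis
    unfolding gaudin_subspace_eq rat_central_line sum .
qed

text \<open>The image of \<open>BH(C, h)\<close> has coefficient \<open>0\<close> at \<open>(0, 1)\<close>, because \<open>h\<^sub>1 = 0\<close>, whereas
  all coefficients of \<open>a\<close> times the central element are \<open>a\<close>.\<close>

lemma bethe_central_trivial:
  "\<psi> ` bethe_subspace n (torus_diag n z)
    \<inter> lin_span (rat_holonomy (n + 1)) {rat_central (n + 1)} = {\<zero>\<^bsub>rat_holonomy (n + 1)\<^esub>}"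
proof -
  obtain h0 where h0: "h0 \<in> cartan n" "\<And>j. j \<in> {1..n+1} \<Longrightarrow> coord h0 j = 0"
    using cartan_of_coords[of "\<lambda>_. 0" n] by auto
  have "gaudin_H (n + 1) (\<lambda>i. - (\<chi> i * coord h0 i)) \<chi> = rat_comb (n + 1) (\<lambda>i j. 0)"
    unfolding gaudin_H_eq by (rule rat_comb_cong) (simp add: \<chi>_def h0(2))
  then have zero: "\<zero>\<^bsub>rat_holonomy (n + 1)\<^esub> \<in> \<psi> ` bethe_subspace n (torus_diag n z)
      \<inter> lin_span (rat_holonomy (n + 1)) {rat_central (n + 1)}"
    unfolding \<psi>_bethe_subspace rat_central_line rat_comb_zero[symmetric] using h0(1) by force
  moreover have "rat_comb (n + 1) (\<lambda>i j. a) = \<zero>\<^bsub>rat_holonomy (n + 1)\<^esub>"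
    if h: "h \<in> cartan n" and eq: "gaudin_H (n + 1) (\<lambda>i. - (\<chi> i * coord h i)) \<chi> = rat_comb (n + 1) (\<lambda>i j. a)"
    for h a
  proof -
    have "a = 0"
      using rat_comb_coefficient[OF _ _ _ eq[unfolded gaudin_H_eq], of 0 1] coord_1[OF h]
      by (simp add: \<chi>_def split: if_splits)
    then show ?thesis by (simp only: rat_comb_zero)
  qed
  ultimately show ?thesis
    unfolding \<psi>_bethe_subspace rat_central_line by auto
qed

end

theorem proposition2p11:
  fixes n :: nat
  assumes "n \<ge> 1"
  shows "\<exists>\<psi>.
    \<psi> \<in> lie_hom (trig_holonomy n) (rat_holonomy (n + 1)) \<and>
    inj_on \<psi> (trig_gen_space n) \<and>
    (let Z = rat_central_ideal (n + 1);
         M = lie_quot (rat_holonomy (n + 1)) Z;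
         \<pi> = (\<lambda>x. Z +>\<^bsub>rat_holonomy (n + 1)\<^esub> x)
     in \<pi> \<circ> \<psi> \<in> lie_hom (trig_holonomy n) M \<and>
        (\<pi> \<circ> \<psi>) ` carrier (trig_holonomy n) = carrier M) \<and>
    (\<forall>z. (\<forall>i\<in>{1..n+1}. z i \<noteq> 0) \<and> torus_diag n z \<in> torus_reg n \<longrightarrow>
      (let G = gaudin_subspace (n + 1) (\<lambda>i. if i = 0 then 0 else z i);
           Q = bethe_subspace n (torus_diag n z);
           c = lin_span (rat_holonomy (n + 1)) {rat_central (n + 1)}
       in G = \<psi> ` Q <+>\<^bsub>rat_holonomy (n + 1)\<^esub> c \<and>
          \<psi> ` Q \<inter> c = {\<zero>\<^bsub>rat_holonomy (n + 1)\<^esub>}))"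
proof -
  obtain \<psi> where \<psi>: "trig_to_rat n \<psi>"
    using trig_to_rat_exists[of n] unfolding trig_to_rat_def by blast
  have decomposition: "\<forall>z. (\<forall>i\<in>{1..n+1}. z i \<noteq> 0) \<and> torus_diag n z \<in> torus_reg n \<longrightarrow>
    gaudin_subspace (n + 1) (\<lambda>i. if i = 0 then 0 else z i) = \<psi> ` bethe_subspace n (torus_diag n z)
        <+>\<^bsub>rat_holonomy (n + 1)\<^esub> lin_span (rat_holonomy (n + 1)) {rat_central (n + 1)} \<and>
      \<psi> ` bethe_subspace n (torus_diag n z)
        \<inter> lin_span (rat_holonomy (n + 1)) {rat_central (n + 1)} = {\<zero>\<^bsub>rat_holonomy (n + 1)\<^esub>}"
  proof (intro allI impI)
    fix z assume "(\<forall>i\<in>{1..n+1}. z i \<noteq> 0) \<and> torus_diag n z \<in> torus_reg n"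
    then have nz: "\<And>i. i \<in> {1..n+1} \<Longrightarrow> z i \<noteq> 0" and reg: "torus_diag n z \<in> torus_reg n"
      by blast+
    interpret regular_trig_to_rat n \<psi> z
      by (intro regular_trig_to_rat.intro regular_trig_to_rat_axioms.intro \<psi> nz
          torus_reg_inj_on[OF nz reg])
    show "gaudin_subspace (n + 1) (\<lambda>i. if i = 0 then 0 else z i) = \<psi> ` bethe_subspace n (torus_diag n z)
        <+>\<^bsub>rat_holonomy (n + 1)\<^esub> lin_span (rat_holonomy (n + 1)) {rat_central (n + 1)} \<and>
      \<psi> ` bethe_subspace n (torus_diag n z)
        \<inter> lin_span (rat_holonomy (n + 1)) {rat_central (n + 1)} = {\<zero>\<^bsub>rat_holonomy (n + 1)\<^esub>}"
      using gaudin_subspace_decomposition bethe_central_trivial unfolding \<chi>_def by (rule conjI)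
  qed
  show ?thesis
    unfolding Let_def
    by (rule exI[of _ \<psi>], intro conjI decomposition trig_to_rat.hom[OF \<psi>]
        trig_to_rat.inj_on_trig_gen_space[OF \<psi>] trig_to_rat.surjective_modulo_central[OF \<psi>])
qed

end
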